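(* For any $q>0$, there is a positive random variable $V_q$ such that for any $\lambda,x>0$, $$\lim_{t\to+\infty}\mathbb{P}_x\left[e^{-\lambda Z_{t-q}}\,\middle|\,\zeta=t\right]=\mathrm{E}\left[e^{-\lambda V_q}\right]=e^{-\alpha(\phi(\lambda+\varphi(q))-q)}\,\frac{\psi(\varphi(q))}{\psi(\lambda+\varphi(q))}.$$ Moreover, the distribution of $V_q$ satisfies $$\mathrm{P}(V_q\in\mathrm{d}r)=\frac{r\,\mathrm{P}(W_q\in\mathrm{d}r)}{\mathrm{E}[W_q]},$$ where $W_q$ is the positive random variable with Laplace transform, for $\lambda>0$, $\mathrm{E}[e^{-\lambda W_q}]=\frac{1-e^{-\alpha\phi(\lambda+\varphi(q))}}{1-e^{-\alpha q}}$ if $\alpha>0$ and $\mathrm{E}[e^{-\lambda W_q}]=\frac{\phi(\lambda+\varphi(q))}{q}$ if $\alpha=0$.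
   Context: Branching mechanism: $\psi(\lambda)=\alpha\lambda+\frac12\sigma^2\lambda^2+\int_0^{+\infty}(e^{-\lambda r}-1+\lambda r)\,\pi(\mathrm{d}r)$, $\lambda\ge 0$, where $\alpha\ge 0$, $\sigma\ge 0$ and $\pi$ is a positive Radon measure on $(0,+\infty)$ with $\int_0^{+\infty}(r\wedge r^2)\,\pi(\mathrm{d}r)<+\infty$. It is assumed that $\psi(+\infty)=+\infty$ and $\int^{+\infty}\frac{1}{\psi(\lambda)}\,\mathrm{d}\lambda<+\infty$ (integrability at $+\infty$). CB process: $((Z_t)_{t\ge 0},(\mathbb{P}_x)_{x\ge 0})$ is the $[0,+\infty)$-valued right continuous strong Markov process with left limits, absorbed at $0$, with $\mathbb{P}_x(Z_0=x)=1$, and such that $\mathbb{P}_x[e^{-\lambda Z_t}]=e^{-x u_t(\lambda)}$ for $\lambda>0$, $t\ge 0$, where $\frac{\partial}{\partial t}u_t(\lambda)=-\psi(u_t(\lambda))$, $u_0(\lambda)=\lambda$. $\mathbb{P}_x[\cdot]$ also denotes expectation with respect to $\mathbb{P}_x$. The extinction time is $\zeta:=\inf\{t>0: Z_t=0\}$. $\phi(\lambda):=\int_\lambda^{+\infty}\frac{1}{\psi(u)}\,\mathrm{d}u$ for $\lambda>0$, which is a strictly decreasing bijection of $(0,+\infty)$, and $\varphi:(0,+\infty)\to(0,+\infty)$ is its inverse function. Conditioning on extinction at time $t$: for $0<q<t$ and $x>0$, the probability measure $\mathbb{P}_x(Z_{t-q}\in\cdot\,|\,\zeta=t)$ on $(0,+\infty)$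 is defined by $$\mathbb{P}_x(Z_{t-q}\in\cdot\,|\,\zeta=t):=\lim_{s\to0+}\mathbb{P}_x(Z_{t-q}\in\cdot\,|\,t\le\zeta<t+s)=\frac{\mathbb{P}_x\left[Z_{t-q}e^{-\varphi(q)Z_{t-q}};\,Z_{t-q}\in\cdot\right]}{\mathbb{P}_x\left[Z_{t-q}e^{-\varphi(q)Z_{t-q}}\right]},$$ and $\mathbb{P}_x[e^{-\lambda Z_{t-q}}|\zeta=t]$ is its Laplace transform at $\lambda$. *)

theory Defs
  imports "HOL-Probability.Probability"
begin

text \<open>
  The measure \<open>\<pi>\<close> lives on the open half-line, so it has space \<open>{0<..}\<close> and its Borel sets.
  The function \<open>\<psi>\<close> is constrained on its domain \<open>[0, \<infinity>)\<close> only.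
\<close>

locale branching_mechanism =
  fixes \<alpha> \<sigma> :: real and \<pi> :: "real measure" and \<psi> :: "real \<Rightarrow> real"
  assumes alpha_nonneg: "0 \<le> \<alpha>"
    and sigma_nonneg: "0 \<le> \<sigma>"
    and sets_pi: "sets \<pi> = sets (restrict_space borel {0<..})"
    and radon_pi: "\<And>a b. 0 < a \<Longrightarrow> emeasure \<pi> {a..b} < \<infinity>"
    and integrable_pi: "integrable \<pi> (\<lambda>r. min r (r\<^sup>2))"
    and psi_eq: "\<And>l. 0 \<le> l \<Longrightarrow>
      \<psi> l = \<alpha> * l + \<sigma>\<^sup>2 * l\<^sup>2 / 2 + (LINT r|\<pi>. exp (- l * r) - 1 + l * r)"
    and psi_at_top: "filterlim \<psi> at_top at_top"
    and inverse_psi_integrable: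
      "\<exists>a>0. set_integrable lborel {a..} (\<lambda>l. 1 / \<psi> l)"

definition phi :: "(real \<Rightarrow> real) \<Rightarrow> real \<Rightarrow> real" where
  "phi \<psi> l = (LINT u:{l..}|lborel. 1 / \<psi> u)"

definition varphi :: "(real \<Rightarrow> real) \<Rightarrow> real \<Rightarrow> real" where
  "varphi \<psi> = the_inv_into {0<..} (phi \<psi>)"

text \<open>
  The process is \<open>Z t \<omega>\<close> for real \<open>t \<ge> 0\<close>, under the laws \<open>P x\<close>, \<open>x \<ge> 0\<close>; other arguments
  are irrelevant. It is adapted to a filtration \<open>F\<close> indexed by \<open>[0, \<infinity>]\<close> (as \<open>ennreal\<close>),
  so that stopping times may be infinite; \<open>F \<infinity>\<close> is the \<open>\<sigma>\<close>-algebra carrying the laws.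
  The strong Markov property is the statement
  \<open>P\<^sub>x(Z\<^sub>T\<^sub>+\<^sub>t \<in> B | F\<^sub>T) = P\<^bsub>Z\<^sub>T\<^esub>(Z\<^sub>t \<in> B)\<close> on \<open>{T < \<infinity>}\<close>, integrated over the events of \<open>F\<^sub>T\<close>.
\<close>

locale cb_process =
  filtration \<Omega> F for \<Omega> :: "'w set" and F :: "ennreal \<Rightarrow> 'w measure" +
  fixes \<psi> :: "real \<Rightarrow> real"
    and u :: "real \<Rightarrow> real \<Rightarrow> real"
    and P :: "real \<Rightarrow> 'w measure"
    and Z :: "real \<Rightarrow> 'w \<Rightarrow> real"
  assumes prob_space_P: "\<And>x. 0 \<le> x \<Longrightarrow> prob_space (P x)"
    and sets_P: "\<And>x. 0 \<le> x \<Longrightarrow> sets (P x) = sets (F \<infinity>)"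
    and adapted: "\<And>t. 0 \<le> t \<Longrightarrow> Z t \<in> borel_measurable (F (ennreal t))"
    and Z_nonneg: "\<And>t \<omega>. 0 \<le> t \<Longrightarrow> \<omega> \<in> \<Omega> \<Longrightarrow> 0 \<le> Z t \<omega>"
    and right_continuous:
      "\<And>t \<omega>. 0 \<le> t \<Longrightarrow> \<omega> \<in> \<Omega> \<Longrightarrow> continuous (at_right t) (\<lambda>s. Z s \<omega>)"
    and left_limits:
      "\<And>t \<omega>. 0 < t \<Longrightarrow> \<omega> \<in> \<Omega> \<Longrightarrow> \<exists>l. ((\<lambda>s. Z s \<omega>) \<longlongrightarrow> l) (at_left t)"
    and absorbed:
      "\<And>s t \<omega>. 0 \<le> s \<Longrightarrow> s \<le> t \<Longrightarrow> \<omega> \<in> \<Omega> \<Longrightarrow> Z s \<omega> = 0 \<Longrightarrow> Z t \<omega> = 0"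
    and Z_start: "\<And>x. 0 \<le> x \<Longrightarrow> AE \<omega> in P x. Z 0 \<omega> = x"
    and transition_measurable:
      "\<And>t B. 0 \<le> t \<Longrightarrow> B \<in> sets borel \<Longrightarrow>
        (\<lambda>x. emeasure (P x) {\<omega> \<in> \<Omega>. Z t \<omega> \<in> B}) \<in> borel_measurable (restrict_space borel {0..})"
    and strong_markov:
      "\<And>x T t A B. 0 \<le> x \<Longrightarrow> stopping_time F T \<Longrightarrow> 0 \<le> t \<Longrightarrow>
        A \<in> sets (pre_sigma T) \<Longrightarrow> B \<in> sets borel \<Longrightarrow>
        emeasure (P x) {\<omega> \<in> A. T \<omega> < \<infinity> \<and> Z (enn2real (T \<omega>) + t) \<omega> \<in> B} =
        (\<integral>\<^sup>+\<omega>\<in>{\<omega> \<in> A. T \<omega> < \<infinity>}.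
           emeasure (P (Z (enn2real (T \<omega>)) \<omega>)) {\<omega>' \<in> \<Omega>. Z t \<omega>' \<in> B} \<partial>P x)"
    and u_0: "\<And>l. 0 < l \<Longrightarrow> u 0 l = l"
    and u_nonneg: "\<And>t l. 0 \<le> t \<Longrightarrow> 0 < l \<Longrightarrow> 0 \<le> u t l"
    and u_ode: "\<And>t l. 0 \<le> t \<Longrightarrow> 0 < l \<Longrightarrow>
      ((\<lambda>s. u s l) has_real_derivative - \<psi> (u t l)) (at t within {0..})"
    and laplace_Z: "\<And>x t l. 0 \<le> x \<Longrightarrow> 0 \<le> t \<Longrightarrow> 0 < l \<Longrightarrow>
      (LINT \<omega>|P x. exp (- l * Z t \<omega>)) = exp (- x * u t l)"

definition extinction_time :: "(real \<Rightarrow> 'w \<Rightarrow> real) \<Rightarrow> 'w \<Rightarrow> ennreal" where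
  "extinction_time Z \<omega> = Inf {ennreal t |t. 0 < t \<and> Z t \<omega> = 0}"

text \<open>
  The law \<open>P\<^sub>x(Z\<^sub>t\<^sub>-\<^sub>q \<in> \<cdot> | \<zeta> = t)\<close> on \<open>(0, \<infinity>)\<close>, as the setwise limit of the
  conditional laws given \<open>t \<le> \<zeta> < t + s\<close>. Note that \<^const>\<open>measure_of\<close> would give
  the zero measure if the limiting set function were not a measure.
\<close>

definition cond_extinction_law ::
    "(real \<Rightarrow> 'w measure) \<Rightarrow> (real \<Rightarrow> 'w \<Rightarrow> real) \<Rightarrow> real \<Rightarrow> real \<Rightarrow> real \<Rightarrow> real measure" where
  "cond_extinction_law P Z x q t =
    measure_of {0<..} (sets (restrict_space borel {0<..}))
      (\<lambda>A. ennreal (Lim (at_right 0) (\<lambda>s::real.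
         \<P>(\<omega> in P x. Z (t - q) \<omega> \<in> A \<bar>
            ennreal t \<le> extinction_time Z \<omega> \<and> extinction_time Z \<omega> < ennreal (t + s)))))"

definition positive_rv :: "'b measure \<Rightarrow> ('b \<Rightarrow> real) \<Rightarrow> bool" where
  "positive_rv N X \<longleftrightarrow> prob_space N \<and> X \<in> borel_measurable N \<and> (AE w in N. 0 < X w)"

definition is_W :: "real \<Rightarrow> (real \<Rightarrow> real) \<Rightarrow> real \<Rightarrow> 'b measure \<Rightarrow> ('b \<Rightarrow> real) \<Rightarrow> bool" where
  "is_W \<alpha> \<psi> q N W \<longleftrightarrow> positive_rv N W \<and>
    (\<forall>l>0. (LINT w|N. exp (- l * W w)) =
      (if \<alpha> > 0
       then (1 - exp (- \<alpha> * phi \<psi> (l + varphi \<psi> q))) / (1 - exp (- \<alpha> * q))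
       else phi \<psi> (l + varphi \<psi> q) / q))"

end

theory Submission
  imports Defs "HOL-Real_Asymp.Real_Asymp"
begin

text \<open>
  Write \<open>v = \<phi>\<^sup>-\<^sup>1(q)\<close>, which is \<^term>\<open>varphi \<psi> q\<close>, and \<open>r = t - q\<close>. The proof rests on four ideas.

  \<^item> The equation for \<open>u\<close> linearises under \<open>\<phi>\<close>, so \<open>u\<^sub>t(\<lambda>) = \<phi>\<^sup>-\<^sup>1(t + \<phi>(\<lambda>))\<close>
    (\<open>u_eq_varphi\<close>). Letting \<open>\<lambda>\<close> tend to infinity, the population is extinct by time \<open>t\<close> with
    probability \<open>exp (- x \<phi>\<^sup>-\<^sup>1(t))\<close>. By the Markov property at time \<open>r\<close>, the event
    \<open>t \<le> \<zeta> < t + s\<close> has conditional probability \<open>exp (- w Z\<^sub>r) - exp (- v Z\<^sub>r)\<close> with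
    \<open>w = \<phi>\<^sup>-\<^sup>1(q + s)\<close>. Dividing numerator and denominator of the conditional probability by
    \<open>v - w\<close> turns the limit \<open>s \<rightarrow> 0\<close> into a left derivative at \<open>v\<close>, so that conditioning on
    \<open>\<zeta> = t\<close> weights \<open>P\<^sub>x\<close> by \<open>Z\<^sub>r exp (- v Z\<^sub>r)\<close> (\<open>cond_extinction_law_eq\<close>).

  \<^item> Hence the conditional Laplace transform is a quotient of derivatives of
    \<open>\<lambda> \<mapsto> exp (- x u\<^sub>r(\<lambda>))\<close>, which the chain rule makes explicit (\<open>size_biased_expectation\<close>). As
    \<open>t \<rightarrow> \<infinity>\<close> all that matters is the quotient of \<open>\<psi>(\<phi>\<^sup>-\<^sup>1(t + c))\<close> and \<open>\<psi>(\<phi>\<^sup>-\<^sup>1(t))\<close>,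
    where \<open>c = \<phi>(\<lambda> + v) - q\<close>. Since \<open>ln \<phi>\<^sup>-\<^sup>1\<close> has derivative \<open>- \<psi>(\<phi>\<^sup>-\<^sup>1(t)) / \<phi>\<^sup>-\<^sup>1(t) \<rightarrow> - \<alpha>\<close>, this quotient tends to
    \<open>exp (- \<alpha> c)\<close> (\<open>psi_varphi_shift_ratio\<close>).

  \<^item> The limiting function tends to 1 at 0 and to 0 at infinity. A continuity theorem for
    Laplace transforms (\<open>laplace_continuity\<close>) provides a positive random variable \<open>V\<close> with this
    transform.

  \<^item> Integrating the transform \<open>E[exp (- \<lambda> V)]\<close> over \<open>[l, \<infinity>)\<close> gives \<open>E[exp (- l V) / V]\<close>, and the integral
    has an elementary primitive. Thus the law of \<open>V\<close> reweighted by \<open>1/V\<close> has the transform required of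
    \<open>W\<close>, and uniqueness of Laplace transforms (\<open>distr_eq_if_laplace_eq\<close>) makes every admissible \<open>W\<close>
    have that law. Size-biasing it gives back \<open>V\<close> (\<open>inverse_size_bias\<close>).

  The two facts on Laplace transforms are both obtained by passing from \<open>X\<close> to \<open>exp (- X)\<close>, which
  takes values in \<open>[0, 1]\<close>: there moments determine the law and tightness is automatic.
\<close>

section \<open>Laplace transforms of positive random variables\<close>

text \<open>
  On a bounded interval the exponential series of \<open>iexp (t * y)\<close> may be integrated term by term;
  hence a law on \<open>[-1, 1]\<close> is determined by its moments.
\<close>

lemma char_eq_moment_series:
  assumes "real_distribution M" and bd: "AE y in M. \<bar>y\<bar> \<le> 1"
  shows "char M t = (\<Sum>n. (\<i> * of_real t) ^ n / fact n * of_real (LINT y|M. y ^ n))"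
proof -
  interpret real_distribution M by fact
  let ?f = "\<lambda>(n::nat) (y::real). (\<i> * of_real t) ^ n / fact n * complex_of_real (y ^ n)"
  have int_pow: "integrable M (\<lambda>y. y ^ n)" for n
    by (rule integrable_const_bound[where B = 1])
       (use bd in \<open>auto elim!: eventually_mono simp: power_abs intro!: power_le_one\<close>)
  have int: "integrable M (?f n)" for n
    by (intro integrable_mult_right integrable_of_real int_pow)
  have norm_f: "norm (?f n y) = \<bar>t\<bar> ^ n / fact n * \<bar>y\<bar> ^ n" for n y
    by (simp add: norm_mult norm_divide norm_power power_abs)
  have summ: "summable (\<lambda>n. \<bar>t\<bar> ^ n / fact n * \<bar>y\<bar> ^ n)" for y
    using summable_exp_generic[of "\<bar>t * y\<bar>"]
    by (simp add: divide_inverse_commute power_mult_distrib abs_mult scaleR_conv_of_real mult_ac)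
  have norm_le: "(LINT y|M. norm (?f n y)) \<le> \<bar>t\<bar> ^ n / fact n" for n
  proof -
    have "(LINT y|M. norm (?f n y)) \<le> (LINT y|M. \<bar>t\<bar> ^ n / fact n)"
      using bd by (intro integral_mono_AE integrable_norm int)
        (auto elim!: eventually_mono simp only: norm_f intro!: mult_left_le power_le_one divide_nonneg_nonneg zero_le_power abs_ge_zero fact_ge_zero)
    also have "\<dots> = \<bar>t\<bar> ^ n / fact n" using prob_space by (simp del: space_eq_univ)
    finally show ?thesis .
  qed
  have "(\<lambda>n. LINT y|M. ?f n y) sums (LINT y|M. (\<Sum>n. ?f n y))"
  proof (rule sums_integral)
    show "AE y in M. summable (\<lambda>n. norm (?f n y))"
      unfolding norm_f using summ by simp
    have "summable (\<lambda>n. \<bar>t\<bar> ^ n / fact n)"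
      using summ[of 1] by simp
    then show "summable (\<lambda>n. LINT y|M. norm (?f n y))"
      by (rule summable_comparison_test[rotated]) (use norm_le in auto)
  qed (rule int)
  moreover have "(\<Sum>n. ?f n y) = iexp (t * y)" for y
    by (simp add: exp_def power_mult_distrib scaleR_conv_of_real divide_inverse mult_ac)
  ultimately have "char M t = (\<Sum>n. LINT y|M. ?f n y)"
    by (simp only: char_def sums_iff)
  also have "\<dots> = (\<Sum>n. (\<i> * of_real t) ^ n / fact n * of_real (LINT y|M. y ^ n))"
    by (simp only: integral_mult_right_zero integral_complex_of_real)
  finally show ?thesis .
qed

text \<open>
  The Laplace transform of \<open>X\<close> at the positive integer \<open>n\<close> is the \<open>n\<close>-th moment of
  \<open>exp (- X)\<close>, and the law of \<open>X\<close> can be recovered from that of \<open>exp (- X)\<close> by \<open>- ln\<close>.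
\<close>

lemma distr_eq_if_laplace_eq:
  fixes X :: "'a \<Rightarrow> real" and Y :: "'b \<Rightarrow> real"
  assumes X: "positive_rv M X" and Y: "positive_rv N Y"
    and eq: "\<And>l. l > 0 \<Longrightarrow> (LINT w|M. exp (- l * X w)) = (LINT w|N. exp (- l * Y w))"
  shows "distr M borel X = distr N borel Y"
proof -
  interpret M: prob_space M using X by (simp add: positive_rv_def)
  interpret N: prob_space N using Y by (simp add: positive_rv_def)
  have [measurable]: "X \<in> borel_measurable M" "Y \<in> borel_measurable N"
    and pos: "AE w in M. 0 < X w" "AE w in N. 0 < Y w"
    using X Y by (auto simp: positive_rv_def)
  define M' where "M' = distr M borel (\<lambda>w. exp (- X w))"
  define N' where "N' = distr N borel (\<lambda>w. exp (- Y w))"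
  have M': "real_distribution M'" and N': "real_distribution N'"
    unfolding M'_def N'_def by (auto intro!: M.real_distribution_distr N.real_distribution_distr)
  have moments: "(LINT y|M'. y ^ n) = (LINT y|N'. y ^ n)" for n
  proof (cases "n = 0")
    case True
    then show ?thesis
      using M' N' by (simp add: real_distribution_def prob_space.prob_space)
  next
    case False
    then show ?thesis
      using eq[of "real n"] by (simp add: M'_def N'_def integral_distr exp_of_nat_mult[symmetric])
  qed
  have "char M' = char N'"
  proof
    fix t
    have "AE y in M'. \<bar>y\<bar> \<le> 1" "AE y in N'. \<bar>y\<bar> \<le> 1"
      unfolding M'_def N'_def using pos by (subst AE_distr_iff; auto elim: eventually_mono)+
    then show "char M' t = char N' t"
      by (simp add: char_eq_moment_series M' N' moments)
  qed
  then have "M' = N'" by (rule Levy_uniqueness[OF M' N'])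
  then have "distr M' borel (\<lambda>y. - ln y) = distr N' borel (\<lambda>y. - ln y)" by simp
  then show ?thesis
    by (simp add: M'_def N'_def distr_distr comp_def)
qed

text \<open>
  The laws of \<open>exp (- X n)\<close> live on \<open>[0, 1]\<close>, so Helly's theorem gives a weakly convergent
  subsequence. Testing against \<open>y \<mapsto> y powr l\<close> shows that a limit variable \<open>y\<close> satisfies
  \<open>E[y powr l] = g l\<close>. The behaviour of \<open>g\<close> at \<open>0\<close> and at \<open>\<infinity>\<close> says that \<open>y\<close> puts no mass on
  \<open>0\<close> and on \<open>1\<close>, that is, that \<open>- ln y\<close> is finite and positive.
\<close>

lemma laplace_continuity:
  fixes M :: "nat \<Rightarrow> 'a measure" and X :: "nat \<Rightarrow> 'a \<Rightarrow> real" and g :: "real \<Rightarrow> real"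
  assumes prob: "\<And>n. prob_space (M n)"
    and [measurable]: "\<And>n. X n \<in> borel_measurable (M n)"
    and nonneg: "\<And>n. AE w in M n. 0 \<le> X n w"
    and lim: "\<And>l. l > 0 \<Longrightarrow> (\<lambda>n. LINT w|M n. exp (- l * X n w)) \<longlonglongrightarrow> g l"
    and g0: "(g \<longlongrightarrow> 1) (at_right 0)" and ginf: "(g \<longlongrightarrow> 0) at_top"
  shows "\<exists>(N :: real measure) V. positive_rv N V \<and> (\<forall>l>0. (LINT w|N. exp (- l * V w)) = g l)"
proof -
  define \<nu> where "\<nu> n = distr (M n) borel (\<lambda>w. exp (- X n w))" for n
  \<comment> \<open>The clipping makes \<open>y powr l\<close> bounded and continuous on the whole line.\<close>
  define h :: "real \<Rightarrow> real \<Rightarrow> real" where "h l y = (max 0 (min 1 y)) powr l" for l y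
  have \<nu>: "real_distribution (\<nu> n)" for n
    unfolding \<nu>_def by (intro prob_space.real_distribution_distr prob) simp
  have "measure (\<nu> n) {-1<..1} = 1" for n
  proof -
    interpret real_distribution "\<nu> n" by (rule \<nu>)
    have "AE y in \<nu> n. y \<in> {-1<..1}"
      unfolding \<nu>_def using nonneg[of n]
      by (subst AE_distr_iff) (auto elim!: eventually_mono intro: less_trans[of _ 0])
    then show ?thesis by (simp add: prob_eq_1)
  qed
  then have "tight \<nu>"
    unfolding tight_def using \<nu>
    by (intro conjI allI impI exI[where x = "-1 :: real"] exI[where x = "1 :: real"]) auto
  from tight_imp_convergent_subsubsequence[OF this strict_mono_id]
  obtain r N where r: "strict_mono (r :: nat \<Rightarrow> nat)" and N: "real_distribution N"
    and conv: "weak_conv_m (\<nu> \<circ> r) N"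
    by auto
  interpret N: real_distribution N by fact
  have h_bd: "norm (h l y) \<le> 1" if "l > 0" for l y
    using that by (auto simp: h_def intro!: powr_le1)
  have h_cont: "continuous_on UNIV (h l)" if "l > 0" for l
    unfolding h_def using that by (intro continuous_on_powr' continuous_intros) auto
  have h_meas [measurable]: "h l \<in> borel_measurable borel" for l
    unfolding h_def by measurable
  have h_int: "(LINT y|N. h l y) = g l" if l: "l > 0" for l
  proof -
    have "(\<lambda>n. LINT y|(\<nu> \<circ> r) n. h l y) \<longlonglongrightarrow> (LINT y|N. h l y)"
      using \<nu> N conv h_cont[OF l] h_bd[OF l]
      by (intro weak_conv_imp_integral_bdd_continuous_conv)
         (auto simp: continuous_on_eq_continuous_at comp_def)
    moreover have "(LINT y|(\<nu> \<circ> r) n. h l y) = (LINT w|M (r n). exp (- l * X (r n) w))" for n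
    proof -
      have "(LINT y|(\<nu> \<circ> r) n. h l y) = (LINT w|M (r n). h l (exp (- X (r n) w)))"
        by (simp add: \<nu>_def integral_distr)
      also have "\<dots> = (LINT w|M (r n). exp (- l * X (r n) w))"
        using nonneg[of "r n"]
        by (intro integral_cong_AE) (auto elim!: eventually_mono simp: h_def powr_def min_def)
      finally show ?thesis .
    qed
    moreover have "(\<lambda>n. LINT w|M (r n). exp (- l * X (r n) w)) \<longlonglongrightarrow> g l"
      using LIMSEQ_subseq_LIMSEQ[OF lim[OF l] r] by (simp add: comp_def)
    ultimately show ?thesis using LIMSEQ_unique by auto
  qed
  have gt0: "AE y in N. 0 < y"
  proof -
    have l: "filterlim (\<lambda>n. 1 / real (Suc n)) (at_right 0) sequentially"
      unfolding filterlim_at_right_to_top by real_asymp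
    have "(\<lambda>n. LINT y|N. h (1 / real (Suc n)) y) \<longlonglongrightarrow> (LINT y|N. indicator {0<..} y)"
    proof (rule integral_dominated_convergence[where w = "\<lambda>_. 1"])
      show "AE y in N. (\<lambda>n. h (1 / real (Suc n)) y) \<longlonglongrightarrow> indicator {0<..} y"
      proof (rule AE_I2)
        fix y :: real
        have lim0: "(\<lambda>n. 1 / real (Suc n)) \<longlonglongrightarrow> 0"
          using l by (simp add: filterlim_at)
        show "(\<lambda>n. h (1 / real (Suc n)) y) \<longlonglongrightarrow> indicator {0<..} y"
        proof (cases "y > 0")
          case True
          then have "(\<lambda>n. (max 0 (min 1 y)) powr (1 / real (Suc n))) \<longlonglongrightarrow> (max 0 (min 1 y)) powr 0"
            by (intro tendsto_intros lim0) auto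
          moreover have "min 1 y \<noteq> 0" using True by auto
          ultimately show ?thesis using True by (simp add: h_def)
        qed (simp add: h_def)
      qed
    qed (use h_bd in auto)
    moreover have "(\<lambda>n. LINT y|N. h (1 / real (Suc n)) y) \<longlonglongrightarrow> 1"
      using filterlim_compose[OF g0 l] by (simp add: h_int)
    ultimately have "N.prob {0<..} = 1"
      using LIMSEQ_unique by fastforce
    then show ?thesis using N.prob_eq_1[of "{0<..}"] by simp
  qed
  have lt1: "AE y in N. y < 1"
  proof -
    have l: "filterlim (\<lambda>n. real (Suc n)) at_top sequentially"
      by real_asymp
    have "(\<lambda>n. LINT y|N. h (real (Suc n)) y) \<longlonglongrightarrow> (LINT y|N. indicator {1..} y)"
    proof (rule integral_dominated_convergence[where w = "\<lambda>_. 1"])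
      show "AE y in N. (\<lambda>n. h (real (Suc n)) y) \<longlonglongrightarrow> indicator {1..} y"
      proof (rule AE_I2)
        fix y :: real
        show "(\<lambda>n. h (real (Suc n)) y) \<longlonglongrightarrow> indicator {1..} y"
        proof (cases "0 < y \<and> y < 1")
          case True
          then have "(\<lambda>n. y ^ Suc n) \<longlonglongrightarrow> 0"
            by (intro LIMSEQ_Suc LIMSEQ_realpow_zero) auto
          then show ?thesis using True by (simp add: h_def powr_realpow del: power_Suc of_nat_Suc)
        qed (auto simp: h_def)
      qed
    qed (use h_bd in auto)
    moreover have "(\<lambda>n. LINT y|N. h (real (Suc n)) y) \<longlonglongrightarrow> 0"
      using filterlim_compose[OF ginf l] by (simp add: h_int)
    ultimately have "N.prob {1..} = 0"
      using LIMSEQ_unique by fastforce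
    then have "AE y in N. y \<notin> {1..}"
      by (subst (asm) N.prob_eq_0) auto
    then show ?thesis by (simp add: not_le)
  qed
  have "positive_rv N (\<lambda>y. - ln y)"
    unfolding positive_rv_def using gt0 lt1 N.prob_space_axioms by auto
  moreover have "(LINT y|N. exp (- l * (- ln y))) = g l" if "l > 0" for l
  proof -
    have "(LINT y|N. exp (- l * (- ln y))) = (LINT y|N. h l y)"
      using gt0 lt1 by (intro integral_cong_AE) (auto simp: h_def powr_def)
    then show ?thesis using h_int[OF that] by simp
  qed
  ultimately show ?thesis by blast
qed

lemma exp_difference_quotient_bounds:
  fixes a w v :: real
  assumes a: "0 \<le> a" and w: "0 < w" "w < v"
  shows "0 \<le> (exp (- (w * a)) - exp (- (v * a))) / (v - w)"
    and "(exp (- (w * a)) - exp (- (v * a))) / (v - w) \<le> 1 / w"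
proof -
  have "exp (- (v * a)) \<le> exp (- (w * a))"
    using a w by (simp add: mult_right_mono)
  then show "0 \<le> (exp (- (w * a)) - exp (- (v * a))) / (v - w)"
    using w by simp
  have "exp (- (w * a)) - exp (- (v * a)) = exp (- (w * a)) * (1 - exp (- ((v - w) * a)))"
    by (simp add: algebra_simps flip: exp_add)
  also have "\<dots> \<le> exp (- (w * a)) * ((v - w) * a)"
    using exp_ge_add_one_self[of "- ((v - w) * a)"] by (intro mult_left_mono) auto
  also have "\<dots> = (w * a * exp (- (w * a))) * ((v - w) / w)"
    using w by simp
  also have "\<dots> \<le> 1 * ((v - w) / w)"
  proof (rule mult_right_mono)
    have "w * a \<le> exp (w * a)" using exp_ge_add_one_self[of "w * a"] by linarith
    then show "w * a * exp (- (w * a)) \<le> 1" by (simp add: exp_minus field_simps)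
  qed (use w in simp)
  finally show "(exp (- (w * a)) - exp (- (v * a))) / (v - w) \<le> 1 / w"
    using w by (simp add: field_simps)
qed

text \<open>
  The left derivative is the one that matters here: \<^term>\<open>varphi \<psi>\<close> is decreasing, so
  \<^term>\<open>varphi \<psi> (q + s)\<close> approaches \<^term>\<open>varphi \<psi> q\<close> from below as \<open>s\<close> decreases to 0.
  For \<open>v/2 < w < v\<close> the difference quotients are bounded by \<open>1/w \<le> 2/v\<close>, which permits
  dominated convergence on a probability space with no moment assumption on \<open>X\<close>.
\<close>

lemma laplace_left_derivative:
  fixes X :: "'a \<Rightarrow> real"
  assumes "prob_space M" and [measurable]: "X \<in> borel_measurable M" "B \<in> sets borel"
    and nonneg: "\<And>\<omega>. \<omega> \<in> space M \<Longrightarrow> 0 \<le> X \<omega>" and v: "0 < v"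
  shows "integrable M (\<lambda>\<omega>. indicator B (X \<omega>) * (X \<omega> * exp (- (v * X \<omega>))))" (is "?int")
    and "((\<lambda>w. ((LINT \<omega>|M. indicator B (X \<omega>) * exp (- (w * X \<omega>))) -
              (LINT \<omega>|M. indicator B (X \<omega>) * exp (- (v * X \<omega>)))) / (v - w))
          \<longlongrightarrow> (LINT \<omega>|M. indicator B (X \<omega>) * (X \<omega> * exp (- (v * X \<omega>))))) (at_left v)"
      (is ?lim)
proof -
  interpret prob_space M by fact
  let ?q = "\<lambda>w \<omega>. indicator B (X \<omega>) * ((exp (- (w * X \<omega>)) - exp (- (v * X \<omega>))) / (v - w))"
  have quot: "?q w \<omega> = (indicator B (X \<omega>) * exp (- (w * X \<omega>)) -
      indicator B (X \<omega>) * exp (- (v * X \<omega>))) / (v - w)" for w \<omega>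
    by (simp add: right_diff_distrib)
  have int_exp: "integrable M (\<lambda>\<omega>. indicator B (X \<omega>) * exp (- (w * X \<omega>)))" if "0 < w" for w
    by (rule integrable_const_bound[where B = 1])
       (use nonneg that in \<open>auto intro!: AE_I2 simp: indicator_def\<close>)
  have q_int: "(LINT \<omega>|M. ?q w \<omega>) = ((LINT \<omega>|M. indicator B (X \<omega>) * exp (- (w * X \<omega>))) -
              (LINT \<omega>|M. indicator B (X \<omega>) * exp (- (v * X \<omega>)))) / (v - w)" if "0 < w" for w
    unfolding quot using int_exp[OF that] int_exp[OF v] by simp
  have q_lim: "(\<lambda>n. ?q (S n) \<omega>) \<longlonglongrightarrow> indicator B (X \<omega>) * (X \<omega> * exp (- (v * X \<omega>)))"
    if S: "\<And>n. S n < v" "S \<longlonglongrightarrow> v" for S :: "nat \<Rightarrow> real" and \<omega>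
  proof -
    have "((\<lambda>w. exp (- (w * X \<omega>))) has_real_derivative - (X \<omega> * exp (- (v * X \<omega>)))) (at v)"
      by (auto intro!: derivative_eq_intros)
    then have "((\<lambda>w. (exp (- (w * X \<omega>)) - exp (- (v * X \<omega>))) / (w - v)) \<longlongrightarrow>
        - (X \<omega> * exp (- (v * X \<omega>)))) (at v)"
      by (simp add: has_field_derivative_iff)
    moreover have "filterlim S (at v) sequentially"
      using S by (auto simp: filterlim_at less_imp_neq)
    ultimately have "(\<lambda>n. (exp (- (S n * X \<omega>)) - exp (- (v * X \<omega>))) / (S n - v)) \<longlonglongrightarrow>
        - (X \<omega> * exp (- (v * X \<omega>)))"
      by (rule filterlim_compose)
    then have "(\<lambda>n. indicator B (X \<omega>) * - ((exp (- (S n * X \<omega>)) - exp (- (v * X \<omega>))) / (S n - v))) \<longlonglongrightarrow>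
        indicator B (X \<omega>) * - (- (X \<omega> * exp (- (v * X \<omega>))))"
      by (intro tendsto_mult_left tendsto_minus)
    moreover have "- (a / (S n - v)) = a / (v - S n)" for a n
      by (simp add: minus_divide_right)
    ultimately show ?thesis by simp
  qed
  have q_bd: "norm (?q w \<omega>) \<le> 2 / v" if w: "v / 2 < w" "w < v" and "\<omega> \<in> space M" for w \<omega>
  proof -
    have "0 < w" using w v by simp
    note b = exp_difference_quotient_bounds[OF nonneg[OF \<open>\<omega> \<in> space M\<close>] this w(2)]
    have "1 / w \<le> 2 / v" using w v by (simp add: field_simps)
    then have "norm ((exp (- (w * X \<omega>)) - exp (- (v * X \<omega>))) / (v - w)) \<le> 2 / v"
      using b unfolding real_norm_def by linarith
    then show ?thesis using v by (simp add: indicator_def)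
  qed
  show ?int
  proof (rule integrable_const_bound[where B = "1 / v"], rule AE_I2)
    fix \<omega> assume "\<omega> \<in> space M"
    then have "0 \<le> X \<omega>" by (rule nonneg)
    moreover have "v * X \<omega> \<le> exp (v * X \<omega>)"
      using exp_ge_add_one_self[of "v * X \<omega>"] by linarith
    then have "X \<omega> * exp (- (v * X \<omega>)) \<le> 1 / v"
      using v by (simp add: exp_minus field_simps)
    ultimately show "norm (indicator B (X \<omega>) * (X \<omega> * exp (- (v * X \<omega>)))) \<le> 1 / v"
      using v by (simp add: indicator_def)
  qed measurable
  show ?lim
  proof (rule tendsto_at_left_sequentially[of "v / 2"])
    fix S :: "nat \<Rightarrow> real"
    assume S: "\<And>n. S n < v" "\<And>n. v / 2 < S n" "S \<longlonglongrightarrow> v"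
    have "(\<lambda>n. LINT \<omega>|M. ?q (S n) \<omega>) \<longlonglongrightarrow> (LINT \<omega>|M. indicator B (X \<omega>) * (X \<omega> * exp (- (v * X \<omega>))))"
    proof (rule integral_dominated_convergence[where w = "\<lambda>_. 2 / v"])
      show "AE \<omega> in M. (\<lambda>n. ?q (S n) \<omega>) \<longlonglongrightarrow> indicator B (X \<omega>) * (X \<omega> * exp (- (v * X \<omega>)))"
        by (intro AE_I2 q_lim S)
      show "AE \<omega> in M. norm (?q (S n) \<omega>) \<le> 2 / v" for n
        by (intro AE_I2 q_bd S)
    qed simp_all
    moreover have "0 < S n" for n using S(2)[of n] v by simp
    ultimately show "(\<lambda>n. ((LINT \<omega>|M. indicator B (X \<omega>) * exp (- (S n * X \<omega>))) -
              (LINT \<omega>|M. indicator B (X \<omega>) * exp (- (v * X \<omega>)))) / (v - S n)) \<longlonglongrightarrow>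
        (LINT \<omega>|M. indicator B (X \<omega>) * (X \<omega> * exp (- (v * X \<omega>))))"
      by (simp only: q_int)
  qed (use v in simp)
qed

text \<open>
  Tonelli's theorem applied to \<open>exp (- l a) / a = \<integral>\<^bsub>[l, \<infinity>)\<^esub> exp (- s a) ds\<close> reduces the expectation
  to a primitive \<open>F\<close> of the Laplace transform.
\<close>

lemma nn_integral_laplace_over_value:
  assumes V: "positive_rv N V" and l: "0 \<le> l"
    and F: "\<And>s. l \<le> s \<Longrightarrow> (F has_real_derivative (LINT w|N. exp (- s * V w))) (at s)"
    and lim: "(F \<longlongrightarrow> T) at_top"
  shows "(\<integral>\<^sup>+w. ennreal (exp (- l * V w) / V w) \<partial>N) = ennreal (T - F l)"
proof -
  interpret prob_space N using V by (simp add: positive_rv_def)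
  have [measurable]: "V \<in> borel_measurable N" and pos: "AE w in N. 0 < V w"
    using V by (auto simp: positive_rv_def)
  interpret pair_sigma_finite N lborel ..
  have inner: "(\<integral>\<^sup>+s. ennreal (exp (- s * a)) * indicator {l..} s \<partial>lborel) = ennreal (exp (- l * a) / a)"
    if a: "0 < a" for a :: real
  proof -
    have "((\<lambda>s. - exp (- s * a) / a) \<longlongrightarrow> 0) at_top" using a by real_asymp
    then have "(\<integral>\<^sup>+s. ennreal (exp (- s * a)) * indicator {l..} s \<partial>lborel) = 0 - (- exp (- l * a) / a)"
      using a by (intro nn_integral_FTC_atLeast) (auto intro!: derivative_eq_intros)
    then show ?thesis by simp
  qed
  have "(\<integral>\<^sup>+w. ennreal (exp (- l * V w) / V w) \<partial>N) =
      (\<integral>\<^sup>+w. (\<integral>\<^sup>+s. ennreal (exp (- s * V w)) * indicator {l..} s \<partial>lborel) \<partial>N)"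
    using pos by (intro nn_integral_cong_AE) (auto elim!: eventually_mono simp only: inner)
  also have "\<dots> = (\<integral>\<^sup>+s. (\<integral>\<^sup>+w. ennreal (exp (- s * V w)) * indicator {l..} s \<partial>N) \<partial>lborel)"
    by (rule Fubini'[symmetric]) measurable
  also have "\<dots> = (\<integral>\<^sup>+s. ennreal (LINT w|N. exp (- s * V w)) * indicator {l..} s \<partial>lborel)"
  proof (rule nn_integral_cong)
    fix s :: real
    have "(\<integral>\<^sup>+w. ennreal (exp (- s * V w)) \<partial>N) = ennreal (LINT w|N. exp (- s * V w))" if "l \<le> s"
    proof (rule nn_integral_eq_integral)
      show "integrable N (\<lambda>w. exp (- s * V w))"
        by (rule integrable_const_bound[where B = 1])
           (use pos l that in \<open>auto elim!: eventually_mono\<close>)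
    qed simp
    then show "(\<integral>\<^sup>+w. ennreal (exp (- s * V w)) * indicator {l..} s \<partial>N) =
        ennreal (LINT w|N. exp (- s * V w)) * indicator {l..} s"
      by (auto simp: indicator_def)
  qed
  also have "\<dots> = ennreal (T - F l)"
    using F lim by (intro nn_integral_FTC_atLeast) auto
  finally show ?thesis .
qed

text \<open>
  The law \<open>M\<^sub>0\<close>, in which \<open>V\<close> is reweighted by \<open>1/V\<close>, has Laplace transform \<open>J l / J 0\<close> and mean
  \<open>1 / J 0\<close>, and size-biasing it undoes the reweighting. Any other variable with the same transform
  has the same law, so the conclusion transfers to it.
\<close>

lemma inverse_size_bias:
  fixes V :: "'a \<Rightarrow> real"
  assumes V: "positive_rv N V"
    and J: "\<And>l. 0 \<le> l \<Longrightarrow> (\<integral>\<^sup>+w. ennreal (exp (- l * V w) / V w) \<partial>N) = ennreal (J l)"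
    and J0: "0 < J 0" and J_nonneg: "\<And>l. 0 \<le> l \<Longrightarrow> 0 \<le> J l"
  defines "M\<^sub>0 \<equiv> density N (\<lambda>w. ennreal (1 / (J 0 * V w)))"
  shows "positive_rv M\<^sub>0 V"
    and "\<And>l. 0 < l \<Longrightarrow> (LINT w|M\<^sub>0. exp (- l * V w)) = J l / J 0"
    and "\<And>(M :: 'b measure) W. positive_rv M W \<Longrightarrow> (\<And>l. 0 < l \<Longrightarrow> (LINT w|M. exp (- l * W w)) = J l / J 0) \<Longrightarrow>
      integrable M W \<and>
      distr N borel V = density (distr M borel W) (\<lambda>r. ennreal (r / (LINT w|M. W w)))"
proof -
  interpret prob_space N using V by (simp add: positive_rv_def)
  have [measurable]: "V \<in> borel_measurable N" and pos: "AE w in N. 0 < V w"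
    using V by (auto simp: positive_rv_def)
  have laplace_nn: "(\<integral>\<^sup>+w. ennreal (exp (- l * V w)) \<partial>M\<^sub>0) = ennreal (J l / J 0)" if "0 \<le> l" for l
  proof -
    have "(\<integral>\<^sup>+w. ennreal (exp (- l * V w)) \<partial>M\<^sub>0) =
        (\<integral>\<^sup>+w. ennreal (1 / J 0) * ennreal (exp (- l * V w) / V w) \<partial>N)"
      unfolding M\<^sub>0_def using pos J0
      by (subst nn_integral_density)
         (auto intro!: nn_integral_cong_AE elim!: eventually_mono simp: ennreal_mult[symmetric])
    also have "\<dots> = ennreal (1 / J 0) * ennreal (J l)"
      by (subst nn_integral_cmult) (simp_all only: J[OF that], measurable)
    also have "\<dots> = ennreal (J l / J 0)"
      using J0 J_nonneg[OF that] by (simp add: ennreal_mult[symmetric])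
    finally show ?thesis .
  qed
  interpret M0: prob_space M\<^sub>0
  proof
    have "emeasure M\<^sub>0 (space M\<^sub>0) = (\<integral>\<^sup>+w. ennreal (exp (- 0 * V w)) \<partial>M\<^sub>0)" by simp
    then show "emeasure M\<^sub>0 (space M\<^sub>0) = 1"
      using J0 laplace_nn[of 0] by simp
  qed
  have [measurable_cong]: "sets M\<^sub>0 = sets N" by (simp add: M\<^sub>0_def)
  have "AE w in M\<^sub>0. 0 < V w"
    unfolding M\<^sub>0_def using pos by (subst AE_density) auto
  then show M0: "positive_rv M\<^sub>0 V"
    by (simp add: positive_rv_def M0.prob_space_axioms)
  show laplace: "(LINT w|M\<^sub>0. exp (- l * V w)) = J l / J 0" if "0 < l" for l
    using laplace_nn[of l] that J0 J_nonneg[of l] by (subst integral_eq_nn_integral) auto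
  have mean: "integrable M\<^sub>0 V" "(LINT w|M\<^sub>0. V w) = 1 / J 0"
  proof -
    have ae: "AE w in N. 1 / (J 0 * V w) * V w = 1 / J 0"
      using pos J0 by (auto elim!: eventually_mono)
    have nn: "AE w in N. 0 \<le> 1 / (J 0 * V w)"
      using pos J0 by (auto elim!: eventually_mono)
    have "integrable N (\<lambda>w. 1 / (J 0 * V w) * V w) \<longleftrightarrow> integrable N (\<lambda>w. 1 / J 0)"
      using ae by (intro integrable_cong_AE) auto
    then show "integrable M\<^sub>0 V"
      unfolding M\<^sub>0_def using nn by (subst integrable_density) auto
    have "(LINT w|M\<^sub>0. V w) = (LINT w|N. 1 / (J 0 * V w) * V w)"
      unfolding M\<^sub>0_def using nn by (subst integral_density) auto
    also have "\<dots> = (LINT w|N. 1 / J 0)"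
      using ae by (intro integral_cong_AE) auto
    finally show "(LINT w|M\<^sub>0. V w) = 1 / J 0" by (simp add: prob_space)
  qed
  have density_V: "density (distr M\<^sub>0 borel V) (\<lambda>r. ennreal (r / (1 / J 0))) = distr N borel V"
  proof -
    have "density (distr M\<^sub>0 borel V) (\<lambda>r. ennreal (r / (1 / J 0))) =
        distr (density M\<^sub>0 (\<lambda>w. ennreal (V w / (1 / J 0)))) borel V"
      by (rule density_distr) auto
    also have "density M\<^sub>0 (\<lambda>w. ennreal (V w / (1 / J 0))) =
        density N (\<lambda>w. ennreal (1 / (J 0 * V w)) * ennreal (V w / (1 / J 0)))"
      unfolding M\<^sub>0_def by (rule density_density_eq) auto
    also have "\<dots> = density N (\<lambda>w. 1)"
      using pos J0
      by (intro density_cong) (auto elim!: eventually_mono simp: ennreal_mult[symmetric])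
    finally show ?thesis by (simp add: density_1)
  qed
  show "integrable M W \<and>
      distr N borel V = density (distr M borel W) (\<lambda>r. ennreal (r / (LINT w|M. W w)))"
    if W: "positive_rv M W" "\<And>l. 0 < l \<Longrightarrow> (LINT w|M. exp (- l * W w)) = J l / J 0"
    for M :: "'b measure" and W
  proof -
    have [measurable]: "W \<in> borel_measurable M" using W by (simp add: positive_rv_def)
    have eq: "distr M borel W = distr M\<^sub>0 borel V"
      using W M0 by (intro distr_eq_if_laplace_eq) (auto simp: laplace[simplified])
    have "integrable M W \<longleftrightarrow> integrable (distr M borel W) (\<lambda>r. r)"
      by (simp add: integrable_distr_eq)
    also have "\<dots> \<longleftrightarrow> integrable M\<^sub>0 V"
      unfolding eq by (simp add: integrable_distr_eq)
    finally have "integrable M W" using mean by simp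
    moreover have "(LINT w|M. W w) = (LINT r|distr M borel W. r)"
      by (simp add: integral_distr)
    then have "(LINT w|M. W w) = 1 / J 0"
      unfolding eq by (simp add: integral_distr mean)
    then have "distr N borel V = density (distr M borel W) (\<lambda>r. ennreal (r / (LINT w|M. W w)))"
      using density_V by (simp add: eq)
    ultimately show ?thesis by blast
  qed
qed

section \<open>The branching mechanism\<close>

definition exp_remainder :: "real \<Rightarrow> real" where
  "exp_remainder y = exp (- y) - 1 + y"

lemma exp_remainder_nonneg: "0 \<le> exp_remainder y"
  using exp_ge_add_one_self[of "- y"] by (simp add: exp_remainder_def)

lemma borel_measurable_exp_remainder [measurable]: "exp_remainder \<in> borel_measurable borel"
  unfolding exp_remainder_def by measurable

lemma exp_remainder_le: "0 \<le> y \<Longrightarrow> exp_remainder y \<le> y"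
  by (simp add: exp_remainder_def)

lemma exp_remainder_le_square:
  assumes "0 \<le> y" shows "exp_remainder y \<le> y\<^sup>2"
proof -
  have "(\<lambda>x. x\<^sup>2 - exp_remainder x) 0 \<le> (\<lambda>x. x\<^sup>2 - exp_remainder x) y"
  proof (rule DERIV_nonneg_imp_nondecreasing[OF assms])
    fix x :: real assume x: "0 \<le> x" "x \<le> y"
    have "((\<lambda>x. x\<^sup>2 - exp_remainder x) has_real_derivative (2 * x - (1 - exp (- x)))) (at x)"
      unfolding exp_remainder_def by (auto intro!: derivative_eq_intros)
    moreover have "0 \<le> 2 * x - (1 - exp (- x))"
      using exp_ge_add_one_self[of "- x"] x by simp
    ultimately show "\<exists>d. ((\<lambda>x. x\<^sup>2 - exp_remainder x) has_real_derivative d) (at x) \<and> 0 \<le> d" by blast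
  qed
  then show ?thesis by (simp add: exp_remainder_def)
qed

text \<open>
  This bound and the next say that \<open>f(y)/y\<close> increases and \<open>f(y)/y\<^sup>2\<close> decreases for the
  remainder \<open>f\<close>. In multiplicative form they pass directly through the integral against \<open>\<pi>\<close>.
\<close>

lemma exp_remainder_scale_ge:
  assumes "0 \<le> y" "1 \<le> c" shows "c * exp_remainder y \<le> exp_remainder (c * y)"
proof -
  have "(\<lambda>x. exp_remainder (c * x) - c * exp_remainder x) 0 \<le> (\<lambda>x. exp_remainder (c * x) - c * exp_remainder x) y"
  proof (rule DERIV_nonneg_imp_nondecreasing[OF assms(1)])
    fix x :: real assume x: "0 \<le> x" "x \<le> y"
    have "((\<lambda>x. exp_remainder (c * x) - c * exp_remainder x) has_real_derivative
        c * (exp (- x) - exp (- (c * x)))) (at x)"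
      unfolding exp_remainder_def by (auto intro!: derivative_eq_intros simp: algebra_simps)
    moreover have "0 \<le> c * (exp (- x) - exp (- (c * x)))"
      using x assms by (simp add: mult_le_cancel_right1)
    ultimately show "\<exists>d. ((\<lambda>x. exp_remainder (c * x) - c * exp_remainder x) has_real_derivative d) (at x) \<and> 0 \<le> d" by blast
  qed
  then show ?thesis by (simp add: exp_remainder_def)
qed

lemma exp_remainder_scale_le:
  assumes "0 \<le> y" "1 \<le> c" shows "exp_remainder (c * y) \<le> c\<^sup>2 * exp_remainder y"
proof -
  let ?k = "\<lambda>x. c * (1 - exp (- x)) - (1 - exp (- (c * x)))"
  have k: "0 \<le> ?k z" if "0 \<le> z" for z
  proof -
    have "?k 0 \<le> ?k z"
    proof (rule DERIV_nonneg_imp_nondecreasing[OF that])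
      fix x :: real assume x: "0 \<le> x" "x \<le> z"
      have "(?k has_real_derivative c * (exp (- x) - exp (- (c * x)))) (at x)"
        by (auto intro!: derivative_eq_intros simp: algebra_simps)
      moreover have "0 \<le> c * (exp (- x) - exp (- (c * x)))"
        using x assms by (simp add: mult_le_cancel_right1)
      ultimately show "\<exists>d. (?k has_real_derivative d) (at x) \<and> 0 \<le> d" by blast
    qed
    then show ?thesis by simp
  qed
  have "(\<lambda>x. c\<^sup>2 * exp_remainder x - exp_remainder (c * x)) 0 \<le> (\<lambda>x. c\<^sup>2 * exp_remainder x - exp_remainder (c * x)) y"
  proof (rule DERIV_nonneg_imp_nondecreasing[OF assms(1)])
    fix x :: real assume x: "0 \<le> x" "x \<le> y"
    have "((\<lambda>x. c\<^sup>2 * exp_remainder x - exp_remainder (c * x)) has_real_derivative c * ?k x) (at x)"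
      unfolding exp_remainder_def
      by (auto intro!: derivative_eq_intros simp: algebra_simps power2_eq_square)
    moreover have "0 \<le> c * ?k x"
      using k x assms by simp
    ultimately show "\<exists>d. ((\<lambda>x. c\<^sup>2 * exp_remainder x - exp_remainder (c * x)) has_real_derivative d) (at x) \<and> 0 \<le> d"
      by blast
  qed
  then show ?thesis by (simp add: exp_remainder_def)
qed

lemma filterlim_add_const_at_top: "filterlim (\<lambda>t. t + c) at_top at_top" for c :: real
  by real_asymp

text \<open>
  By the mean value theorem the increment over a step \<open>c\<close>, of either sign, is \<open>c\<close> times
  the derivative at a point within \<open>\<bar>c\<bar>\<close> of \<open>t\<close>.
\<close>

lemma increment_tendsto_at_top:
  fixes f f' :: "real \<Rightarrow> real"
  assumes deriv: "\<And>t. t > 0 \<Longrightarrow> (f has_real_derivative f' t) (at t)"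
    and lim: "(f' \<longlongrightarrow> a) at_top"
  shows "((\<lambda>t. f (t + c) - f t) \<longlongrightarrow> c * a) at_top"
proof -
  have ex: "\<exists>z. t - \<bar>c\<bar> \<le> z \<and> f (t + c) - f t = c * f' z" if t: "t > \<bar>c\<bar>" for t
  proof -
    consider "c = 0" | "c > 0" | "c < 0" by linarith
    then show ?thesis
    proof cases
      case 2
      then have "\<exists>z>t. z < t + c \<and> f (t + c) - f t = (t + c - t) * f' z"
        using t by (intro MVT2 deriv) auto
      then obtain z where "z > t" "f (t + c) - f t = (t + c - t) * f' z" by blast
      then show ?thesis using 2 by (intro exI[where x = z]) auto
    next
      case 3
      then have "\<exists>z>t + c. z < t \<and> f t - f (t + c) = (t - (t + c)) * f' z"
        using t by (intro MVT2 deriv) auto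
      then obtain z where "z > t + c" "f t - f (t + c) = (t - (t + c)) * f' z" by blast
      then show ?thesis using 3 by (intro exI[where x = z]) (auto simp: algebra_simps)
    qed auto
  qed
  then obtain z where z: "\<And>t. t > \<bar>c\<bar> \<Longrightarrow> t - \<bar>c\<bar> \<le> z t \<and> f (t + c) - f t = c * f' (z t)"
    by metis
  have "filterlim (\<lambda>t. t - \<bar>c\<bar>) at_top at_top"
    using filterlim_add_const_at_top[of "- \<bar>c\<bar>"] by simp
  then have "filterlim z at_top at_top"
    by (rule filterlim_at_top_mono)
       (use z in \<open>auto intro!: eventually_mono[OF eventually_gt_at_top[of "\<bar>c\<bar>"]]\<close>)
  then have "((\<lambda>t. c * f' (z t)) \<longlongrightarrow> c * a) at_top"
    by (intro tendsto_intros filterlim_compose[OF lim])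
  then show ?thesis
    by (rule Lim_transform_eventually)
       (use z in \<open>auto intro!: eventually_mono[OF eventually_gt_at_top[of "\<bar>c\<bar>"]]\<close>)
qed

context branching_mechanism
begin

lemma space_pi: "space \<pi> = {0<..}"
  using sets_eq_imp_space_eq[OF sets_pi] by simp

lemma measurable_pi: "f \<in> borel_measurable borel \<Longrightarrow> f \<in> borel_measurable \<pi>"
  using measurable_restrict_space1[of f borel borel "{0<..}"] measurable_cong_sets[OF sets_pi refl]
  by blast

lemma exp_remainder_le_min:
  assumes "0 \<le> l" "0 < r"
  shows "exp_remainder (l * r) \<le> (l + l\<^sup>2) * min r (r\<^sup>2)"
proof (cases "r \<le> r\<^sup>2")
  case True
  have "exp_remainder (l * r) \<le> l * r" using assms by (intro exp_remainder_le) simp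
  also have "\<dots> \<le> (l + l\<^sup>2) * r" using assms by (intro mult_right_mono) auto
  finally show ?thesis using True by (simp add: min_absorb1)
next
  case False
  have "exp_remainder (l * r) \<le> (l * r)\<^sup>2" using assms by (intro exp_remainder_le_square) simp
  also have "\<dots> \<le> (l + l\<^sup>2) * r\<^sup>2"
    using assms by (simp add: power_mult_distrib mult_right_mono)
  finally show ?thesis using False by (simp add: min_def)
qed

lemma integrable_exp_remainder: "0 \<le> l \<Longrightarrow> integrable \<pi> (\<lambda>r. exp_remainder (l * r))"
  by (rule Bochner_Integration.integrable_bound[where f = "\<lambda>r. (l + l\<^sup>2) * min r (r\<^sup>2)"])
     (use integrable_pi exp_remainder_le_min[of l] in
       \<open>auto intro!: measurable_pi AE_I2 simp: space_pi exp_remainder_nonneg abs_of_nonneg\<close>)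

lemma psi_eq_exp_remainder:
  "0 \<le> l \<Longrightarrow> \<psi> l = \<alpha> * l + \<sigma>\<^sup>2 * l\<^sup>2 / 2 + (LINT r|\<pi>. exp_remainder (l * r))"
  using psi_eq by (simp add: exp_remainder_def)

text \<open>
  The drift and the Gaussian term share the two scaling inequalities of the exponential remainder.
  Together, the inequalities for \<open>\<psi>\<close> replace any computation of its derivative: positivity,
  monotonicity of \<open>\<psi>(l)/l\<close>, continuity, and the comparison of \<open>\<psi>\<close> at asymptotically equal
  arguments follow from them.
\<close>

lemma psi_scale_ge:
  assumes "0 \<le> l" "1 \<le> c" shows "c * \<psi> l \<le> \<psi> (c * l)"
proof -
  have "c * (LINT r|\<pi>. exp_remainder (l * r)) = (LINT r|\<pi>. c * exp_remainder (l * r))" by simp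
  also have "\<dots> \<le> (LINT r|\<pi>. exp_remainder (c * l * r))"
    using assms exp_remainder_scale_ge[of "l * _" c]
    by (intro integral_mono integrable_mult_right integrable_exp_remainder) (auto simp: space_pi mult.assoc)
  moreover have "c * (\<sigma>\<^sup>2 * l\<^sup>2 / 2) \<le> \<sigma>\<^sup>2 * (c * l)\<^sup>2 / 2"
  proof -
    have "c * (\<sigma>\<^sup>2 * l\<^sup>2) \<le> c\<^sup>2 * (\<sigma>\<^sup>2 * l\<^sup>2)"
      using assms by (intro mult_right_mono) (auto simp: power2_eq_square)
    then show ?thesis by (simp add: power_mult_distrib mult_ac)
  qed
  ultimately show ?thesis using assms by (simp add: psi_eq_exp_remainder algebra_simps)
qed

lemma psi_scale_le:
  assumes "0 \<le> l" "1 \<le> c" shows "\<psi> (c * l) \<le> c\<^sup>2 * \<psi> l"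
proof -
  have "(LINT r|\<pi>. exp_remainder (c * l * r)) \<le> (LINT r|\<pi>. c\<^sup>2 * exp_remainder (l * r))"
    using assms exp_remainder_scale_le[of "l * _" c]
    by (intro integral_mono integrable_mult_right integrable_exp_remainder) (auto simp: space_pi mult.assoc)
  also have "\<dots> = c\<^sup>2 * (LINT r|\<pi>. exp_remainder (l * r))" by simp
  moreover have "\<alpha> * (c * l) \<le> c\<^sup>2 * (\<alpha> * l)"
  proof -
    have "c * (\<alpha> * l) \<le> c\<^sup>2 * (\<alpha> * l)"
      using assms alpha_nonneg by (intro mult_right_mono) (auto simp: power2_eq_square)
    then show ?thesis by (simp add: mult_ac)
  qed
  ultimately show ?thesis using assms by (simp add: psi_eq_exp_remainder algebra_simps power_mult_distrib)
qed

text \<open>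
  By the upper scaling inequality a single nonpositive value of \<open>\<psi>\<close> would force \<open>\<psi>\<close> to stay
  nonpositive from there on, against \<open>\<psi>(\<infinity>) = \<infinity>\<close>.
\<close>

lemma psi_pos:
  assumes "0 < l" shows "0 < \<psi> l"
proof (rule ccontr)
  assume neg: "\<not> 0 < \<psi> l"
  have le: "\<psi> m \<le> 0" if "m \<ge> l" for m
  proof -
    have "\<psi> m \<le> (m / l)\<^sup>2 * \<psi> l"
      using psi_scale_le[of l "m / l"] that assms by simp
    also have "\<dots> \<le> 0" using neg by (intro mult_nonneg_nonpos) auto
    finally show ?thesis .
  qed
  have "eventually (\<lambda>m. \<psi> m > 0) at_top"
    using psi_at_top unfolding filterlim_at_top_dense by blast
  then have "eventually (\<lambda>m::real. False) at_top"
    using eventually_ge_at_top[of l]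
  proof eventually_elim
    case (elim m)
    then show ?case using le[of m] by simp
  qed
  then show False by simp
qed

lemma psi_0: "\<psi> 0 = 0"
  by (simp add: psi_eq_exp_remainder exp_remainder_def)

lemma psi_nonneg: "0 \<le> l \<Longrightarrow> 0 \<le> \<psi> l"
  using psi_pos[of l] psi_0 by (cases "l = 0") auto

lemma psi_div_mono:
  assumes "0 < l" "l \<le> m" shows "\<psi> l / l \<le> \<psi> m / m"
  using psi_scale_ge[of l "m / l"] assms by (simp add: field_simps)

lemma psi_ratio_bounds:
  assumes "0 < l" "0 < m"
  shows "min 1 ((m / l)\<^sup>2) \<le> \<psi> m / \<psi> l" "\<psi> m / \<psi> l \<le> max 1 ((m / l)\<^sup>2)"
proof -
  have *: "1 \<le> \<psi> m / \<psi> l \<and> \<psi> m / \<psi> l \<le> (m / l)\<^sup>2" if "0 < l" "l \<le> m" for l m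
  proof -
    have "1 * \<psi> l \<le> m / l * \<psi> l"
      using that psi_pos[of l] by (intro mult_right_mono) auto
    also have "\<dots> \<le> \<psi> m" using psi_scale_ge[of l "m / l"] that by simp
    finally show ?thesis
      using psi_scale_le[of l "m / l"] psi_pos[of l] that by (simp add: pos_divide_le_eq)
  qed
  have "min 1 ((m / l)\<^sup>2) \<le> \<psi> m / \<psi> l \<and> \<psi> m / \<psi> l \<le> max 1 ((m / l)\<^sup>2)"
  proof (cases "l \<le> m")
    case True
    then show ?thesis using *[of l m] assms by (simp add: min_le_iff_disj le_max_iff_disj)
  next
    case False
    then have "1 \<le> \<psi> l / \<psi> m" "\<psi> l / \<psi> m \<le> (l / m)\<^sup>2" using *[of m l] assms by auto
    then have "inverse ((l / m)\<^sup>2) \<le> inverse (\<psi> l / \<psi> m)" "inverse (\<psi> l / \<psi> m) \<le> 1"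
      using psi_pos[OF assms(1)] psi_pos[OF assms(2)]
      by (intro le_imp_inverse_le inverse_le_1_iff[THEN iffD2]; simp)+
    then have "(m / l)\<^sup>2 \<le> \<psi> m / \<psi> l" "\<psi> m / \<psi> l \<le> 1"
      by (simp_all add: power_divide)
    then show ?thesis by (simp add: min_le_iff_disj le_max_iff_disj)
  qed
  then show "min 1 ((m / l)\<^sup>2) \<le> \<psi> m / \<psi> l" "\<psi> m / \<psi> l \<le> max 1 ((m / l)\<^sup>2)" by auto
qed

text \<open>
  Besides continuity, this serves the case \<open>\<alpha> = 0\<close>, in which \<open>\<psi>(l)/l \<rightarrow> 0\<close> carries no
  information on the ratio of the values of \<open>\<psi>\<close> at two points tending to 0.
\<close>

lemma psi_ratio_tendsto_1:
  assumes "((\<lambda>x. m x / l x) \<longlongrightarrow> 1) F"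
    and "eventually (\<lambda>x. 0 < m x \<and> 0 < l x) F"
  shows "((\<lambda>x. \<psi> (m x) / \<psi> (l x)) \<longlongrightarrow> 1) F"
proof (rule tendsto_sandwich)
  show "eventually (\<lambda>x. min 1 ((m x / l x)\<^sup>2) \<le> \<psi> (m x) / \<psi> (l x)) F"
       "eventually (\<lambda>x. \<psi> (m x) / \<psi> (l x) \<le> max 1 ((m x / l x)\<^sup>2)) F"
    using psi_ratio_bounds by (auto intro: eventually_mono[OF assms(2)])
  have "((\<lambda>x. min 1 ((m x / l x)\<^sup>2)) \<longlongrightarrow> min 1 (1\<^sup>2)) F"
    by (intro tendsto_min tendsto_power tendsto_const assms)
  then show "((\<lambda>x. min 1 ((m x / l x)\<^sup>2)) \<longlongrightarrow> 1) F" by simp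
  have "((\<lambda>x. max 1 ((m x / l x)\<^sup>2)) \<longlongrightarrow> max 1 (1\<^sup>2)) F"
    by (intro tendsto_max tendsto_power tendsto_const assms)
  then show "((\<lambda>x. max 1 ((m x / l x)\<^sup>2)) \<longlongrightarrow> 1) F" by simp
qed

lemma isCont_psi:
  assumes l: "0 < l" shows "isCont \<psi> l"
proof -
  have "((\<lambda>m. \<psi> m / \<psi> l) \<longlongrightarrow> 1) (at l)"
  proof (rule psi_ratio_tendsto_1)
    have "((\<lambda>m. m / l) \<longlongrightarrow> l / l) (at l)" using l by (intro tendsto_intros) auto
    then show "((\<lambda>m. m / l) \<longlongrightarrow> 1) (at l)" using l by simp
    show "eventually (\<lambda>m. 0 < m \<and> 0 < l) (at l)"
      using l eventually_at_in_open'[of "{0<..}" l] by simp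
  qed
  then have "((\<lambda>m. \<psi> m / \<psi> l * \<psi> l) \<longlongrightarrow> 1 * \<psi> l) (at l)"
    by (intro tendsto_intros)
  then show ?thesis using psi_pos[OF l] by (simp add: isCont_def)
qed

lemma isCont_inverse_psi: "0 < l \<Longrightarrow> isCont (\<lambda>v. 1 / \<psi> v) l"
  using psi_pos[of l] by (intro continuous_intros isCont_psi) auto

text \<open>
  The Gaussian term is of order \<open>l\<^sup>2\<close>, and the integrand of the jump term divided by \<open>l\<close> tends to 0
  while being dominated by \<open>2 min(r, r\<^sup>2)\<close>.
\<close>

lemma psi_div_tendsto_alpha: "((\<lambda>l. \<psi> l / l) \<longlongrightarrow> \<alpha>) (at_right 0)"
proof (rule tendsto_at_right_sequentially[of 0 1])
  fix S :: "nat \<Rightarrow> real"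
  assume S: "\<And>n. 0 < S n" "\<And>n. S n < 1" "S \<longlonglongrightarrow> 0"
  have "(\<lambda>n. LINT r|\<pi>. exp_remainder (S n * r) / S n) \<longlonglongrightarrow> (LINT r|\<pi>. 0)"
  proof (rule integral_dominated_convergence[where w = "\<lambda>r. 2 * min r (r\<^sup>2)"])
    show "AE r in \<pi>. (\<lambda>n. exp_remainder (S n * r) / S n) \<longlonglongrightarrow> 0"
    proof (rule AE_I2)
      fix r assume "r \<in> space \<pi>"
      then have r: "0 < r" by (simp add: space_pi)
      have S0: "(\<lambda>n. S n * r\<^sup>2) \<longlonglongrightarrow> 0"
        using tendsto_mult_right[OF S(3), of "r\<^sup>2"] by simp
      show "(\<lambda>n. exp_remainder (S n * r) / S n) \<longlonglongrightarrow> 0"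
      proof (rule Lim_null_comparison[OF always_eventually S0], rule allI)
        fix n
        have "exp_remainder (S n * r) \<le> (S n * r)\<^sup>2"
          using r S(1)[of n] by (intro exp_remainder_le_square) simp
        then show "norm (exp_remainder (S n * r) / S n) \<le> S n * r\<^sup>2"
          using r S(1)[of n] exp_remainder_nonneg[of "S n * r"]
          by (simp add: power_mult_distrib divide_le_eq mult_ac power2_eq_square)
      qed
    qed
    show "AE r in \<pi>. norm (exp_remainder (S n * r) / S n) \<le> 2 * min r (r\<^sup>2)" for n
    proof (rule AE_I2)
      fix r assume "r \<in> space \<pi>"
      then have r: "0 < r" by (simp add: space_pi)
      have "exp_remainder (S n * r) / S n \<le> (S n + (S n)\<^sup>2) * min r (r\<^sup>2) / S n"
        using S(1)[of n] r by (intro divide_right_mono exp_remainder_le_min) auto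
      also have "\<dots> = (1 + S n) * min r (r\<^sup>2)"
        using S(1)[of n] by (simp add: field_simps power2_eq_square)
      also have "\<dots> \<le> 2 * min r (r\<^sup>2)"
        using S(2)[of n] r by (intro mult_right_mono) auto
      finally show "norm (exp_remainder (S n * r) / S n) \<le> 2 * min r (r\<^sup>2)"
        using S(1)[of n] exp_remainder_nonneg[of "S n * r"] by simp
    qed
  qed (use integrable_pi in \<open>auto intro!: measurable_pi\<close>)
  moreover have "(\<lambda>n. \<alpha> + \<sigma>\<^sup>2 * S n / 2) \<longlonglongrightarrow> \<alpha> + \<sigma>\<^sup>2 * 0 / 2"
    by (intro tendsto_intros S) auto
  ultimately have "(\<lambda>n. \<alpha> + \<sigma>\<^sup>2 * S n / 2 + (LINT r|\<pi>. exp_remainder (S n * r) / S n)) \<longlonglongrightarrow> \<alpha> + 0"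
    by (intro tendsto_add) auto
  moreover have "\<alpha> + \<sigma>\<^sup>2 * S n / 2 + (LINT r|\<pi>. exp_remainder (S n * r) / S n) = \<psi> (S n) / S n" for n
    using S(1)[of n] by (simp add: psi_eq_exp_remainder field_simps power2_eq_square)
  ultimately show "(\<lambda>n. \<psi> (S n) / S n) \<longlonglongrightarrow> \<alpha>" by simp
qed simp

section \<open>The extinction function and its inverse\<close>

lemma inverse_psi_integrable_from:
  assumes l: "0 < l" shows "set_integrable lborel {l..} (\<lambda>v. 1 / \<psi> v)"
proof -
  obtain a where a: "a > 0" "set_integrable lborel {a..} (\<lambda>v. 1 / \<psi> v)"
    using inverse_psi_integrable by blast
  define b where "b = max a l"
  have "continuous_on {l..b} (\<lambda>v. 1 / \<psi> v)"
    using l by (intro continuous_at_imp_continuous_on ballI isCont_inverse_psi) auto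
  then have "set_integrable lborel {l..b} (\<lambda>v. 1 / \<psi> v)"
    by (rule borel_integrable_atLeastAtMost')
  moreover have "set_integrable lborel {b..} (\<lambda>v. 1 / \<psi> v)"
    by (rule set_integrable_subset[OF a(2)]) (auto simp: b_def)
  moreover have "{l..} = {l..b} \<union> {b..}"
    by (auto simp: b_def)
  ultimately show ?thesis by (auto intro: set_integrable_Un)
qed

lemma phi_tendsto_0: "(phi \<psi> \<longlongrightarrow> 0) at_top"
  and phi_split: "0 < a \<Longrightarrow> a \<le> b \<Longrightarrow> phi \<psi> a = (LINT v:{a..b}|lborel. 1 / \<psi> v) + phi \<psi> b"
proof -
  show split: "phi \<psi> a = (LINT v:{a..b}|lborel. 1 / \<psi> v) + phi \<psi> b" if "0 < a" "a \<le> b" for a b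
  proof -
    have "(LINT v:{a..b} \<union> {b..}|lborel. 1 / \<psi> v) =
        (LINT v:{a..b}|lborel. 1 / \<psi> v) + (LINT v:{b..}|lborel. 1 / \<psi> v)"
    proof (rule set_integral_Un_AE)
      show "AE x in lborel. \<not> (x \<in> {a..b} \<and> x \<in> {b..})"
        using AE_lborel_singleton[of b] by (auto elim!: eventually_mono)
    qed (use that inverse_psi_integrable_from in \<open>auto intro: set_integrable_subset[OF inverse_psi_integrable_from[of a]]\<close>)
    moreover have "{a..b} \<union> {b..} = {a..}" using that by auto
    ultimately show ?thesis by (simp add: phi_def)
  qed
  have "((\<lambda>b. LINT v:{1..b}|lborel. 1 / \<psi> v) \<longlongrightarrow> (LINT v:{1..}|lborel. 1 / \<psi> v)) at_top"
    by (rule tendsto_set_lebesgue_integral_at_top) (auto intro: inverse_psi_integrable_from)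
  then have "((\<lambda>b. phi \<psi> 1 - (LINT v:{1..b}|lborel. 1 / \<psi> v)) \<longlongrightarrow> phi \<psi> 1 - phi \<psi> 1) at_top"
    unfolding phi_def by (intro tendsto_intros)
  then have "((\<lambda>b. phi \<psi> 1 - (LINT v:{1..b}|lborel. 1 / \<psi> v)) \<longlongrightarrow> 0) at_top"
    by simp
  then show "(phi \<psi> \<longlongrightarrow> 0) at_top"
    by (rule Lim_transform_eventually)
       (auto intro!: eventually_mono[OF eventually_ge_at_top[of 1]] simp: split)
qed

lemma DERIV_phi:
  assumes l: "0 < l" shows "(phi \<psi> has_real_derivative - (1 / \<psi> l)) (at l)"
proof -
  define a where "a = l / 2"
  have cont: "continuous_on {a..2*l} (\<lambda>v. 1 / \<psi> v)"
    using l by (intro continuous_at_imp_continuous_on ballI isCont_inverse_psi) (auto simp: a_def)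
  have "((\<lambda>x. integral {a..x} (\<lambda>v. 1 / \<psi> v)) has_real_derivative 1 / \<psi> l) (at l within {a..2*l})"
    using cont l by (intro integral_has_real_derivative) (auto simp: a_def)
  then have "((\<lambda>x. integral {a..x} (\<lambda>v. 1 / \<psi> v)) has_real_derivative 1 / \<psi> l) (at l)"
    using l by (simp add: at_within_Icc_at a_def)
  then have "((\<lambda>x. phi \<psi> a - integral {a..x} (\<lambda>v. 1 / \<psi> v)) has_real_derivative - (1 / \<psi> l)) (at l)"
    by (auto intro!: derivative_eq_intros)
  then show ?thesis
  proof (rule has_field_derivative_transform_within_open[where S = "{a<..<2*l}"])
    fix x assume x: "x \<in> {a<..<2*l}"
    have "(LINT v:{a..x}|lborel. 1 / \<psi> v) = integral {a..x} (\<lambda>v. 1 / \<psi> v)"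
      using l x
      by (intro set_borel_integral_eq_integral set_integrable_subset[OF inverse_psi_integrable_from[of a]])
         (auto simp: a_def)
    then show "phi \<psi> a - integral {a..x} (\<lambda>v. 1 / \<psi> v) = phi \<psi> x"
      using phi_split[of a x] x l by (simp add: a_def)
  qed (use l in \<open>auto simp: a_def\<close>)
qed

lemma isCont_phi: "0 < l \<Longrightarrow> isCont (phi \<psi>) l"
  by (rule DERIV_isCont[OF DERIV_phi])

lemma phi_strict_anti:
  assumes "0 < a" "a < b" shows "phi \<psi> b < phi \<psi> a"
proof (rule DERIV_neg_imp_decreasing[OF assms(2)])
  fix x assume "a \<le> x" "x \<le> b"
  then have "0 < x" using assms by simp
  then show "\<exists>y. DERIV (phi \<psi>) x :> y \<and> y < 0"
    using psi_pos[of x] DERIV_phi[of x] by (intro exI[where x = "- (1 / \<psi> x)"]) simp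
qed

lemma phi_less_iff: "0 < a \<Longrightarrow> 0 < b \<Longrightarrow> phi \<psi> a < phi \<psi> b \<longleftrightarrow> b < a"
  using phi_strict_anti[of a b] phi_strict_anti[of b a] by (cases a b rule: linorder_cases) auto

lemma phi_nonneg: "0 < l \<Longrightarrow> 0 \<le> phi \<psi> l"
  unfolding phi_def set_lebesgue_integral_def
  by (intro integral_nonneg_AE AE_I2) (auto simp: indicator_def psi_nonneg)

lemma phi_pos: "0 < l \<Longrightarrow> 0 < phi \<psi> l"
  using phi_strict_anti[of l "l + 1"] phi_nonneg[of "l + 1"] by simp

text \<open>
  Since \<open>\<psi>(x) \<le> x \<psi>(1)\<close> on \<open>(0, 1]\<close>, the integral defining \<open>\<phi>\<close> diverges at 0 at least
  logarithmically. This makes \<open>\<phi>\<close> surjective onto the half-line.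
\<close>

lemma phi_ge_ln:
  assumes "0 < l" "l \<le> 1" shows "- ln l / \<psi> 1 \<le> phi \<psi> l"
proof -
  have "(\<lambda>x. phi \<psi> x + ln x / \<psi> 1) 1 \<le> (\<lambda>x. phi \<psi> x + ln x / \<psi> 1) l"
  proof (rule DERIV_nonpos_imp_nonincreasing[OF assms(2)])
    fix x assume x: "l \<le> x" "x \<le> 1"
    then have x0: "0 < x" using assms by simp
    have "((\<lambda>x. phi \<psi> x + ln x / \<psi> 1) has_real_derivative - (1 / \<psi> x) + 1 / x / \<psi> 1) (at x)"
      using x0 psi_pos[of 1] by (auto intro!: derivative_eq_intros DERIV_phi)
    moreover have "- (1 / \<psi> x) + 1 / x / \<psi> 1 \<le> 0"
      using psi_div_mono[of x 1] x x0 psi_pos[of x] psi_pos[of 1] by (simp add: field_simps)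
    ultimately show "\<exists>y. ((\<lambda>x. phi \<psi> x + ln x / \<psi> 1) has_real_derivative y) (at x) \<and> y \<le> 0"
      by blast
  qed
  then show ?thesis using phi_nonneg[of 1] by simp
qed

lemma phi_bij: "bij_betw (phi \<psi>) {0<..} {0<..}"
proof (rule bij_betw_imageI)
  show "inj_on (phi \<psi>) {0<..}"
  proof (rule linorder_inj_onI')
    fix a b :: real assume "a < b" "a \<in> {0<..}"
    then show "phi \<psi> a \<noteq> phi \<psi> b" using phi_strict_anti[of a b] by simp
  qed
  show "phi \<psi> ` {0<..} = {0<..}"
  proof (intro equalityI subsetI)
    fix t :: real assume "t \<in> {0<..}"
    then have t: "0 < t" by simp
    \<comment> \<open>At this point the logarithmic lower bound for \<open>\<phi>\<close> equals \<open>t\<close>.\<close>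
    define a where "a = exp (- t * \<psi> 1)"
    have a: "0 < a" "a \<le> 1" "t \<le> phi \<psi> a"
      using t psi_pos[of 1] phi_ge_ln[of a] by (auto simp: a_def)
    have "eventually (\<lambda>b. phi \<psi> b < t \<and> a \<le> b) at_top"
      by (intro eventually_conj eventually_ge_at_top order_tendstoD(2)[OF phi_tendsto_0 t])
    then obtain b where b: "phi \<psi> b < t" "a \<le> b"
      using eventually_happens'[OF trivial_limit_at_top_linorder] by blast
    have "\<exists>x\<ge>a. x \<le> b \<and> phi \<psi> x = t"
      using a b by (intro IVT2) (auto intro!: isCont_phi)
    then show "t \<in> phi \<psi> ` {0<..}" using a by (auto intro: less_le_trans)
  qed (auto intro: phi_pos)
qed

lemma varphi_pos: "0 < t \<Longrightarrow> 0 < varphi \<psi> t"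
  using bij_betw_apply[OF bij_betw_the_inv_into[OF phi_bij], of t] by (simp add: varphi_def)

lemma phi_varphi: "0 < t \<Longrightarrow> phi \<psi> (varphi \<psi> t) = t"
  unfolding varphi_def
  by (rule f_the_inv_into_f_bij_betw[OF phi_bij]) simp

lemma varphi_phi: "0 < l \<Longrightarrow> varphi \<psi> (phi \<psi> l) = l"
  unfolding varphi_def
  by (rule the_inv_into_f_f[OF bij_betw_imp_inj_on[OF phi_bij]]) simp

lemma varphi_strict_anti: "0 < s \<Longrightarrow> s < t \<Longrightarrow> varphi \<psi> t < varphi \<psi> s"
  using phi_less_iff[of "varphi \<psi> s" "varphi \<psi> t"] by (simp add: varphi_pos phi_varphi)

lemma isCont_varphi:
  assumes t: "0 < t" shows "isCont (varphi \<psi>) t"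
proof -
  define l where "l = varphi \<psi> t"
  have l: "0 < l" "phi \<psi> l = t" using t by (auto simp: l_def varphi_pos phi_varphi)
  have pos: "0 < z" if "\<bar>z - l\<bar> \<le> l / 2" for z
    using that l by linarith
  have "isCont (varphi \<psi>) (phi \<psi> l)"
  proof (rule isCont_inverse_function[where f = "phi \<psi>" and x = l and d = "l / 2"])
    show "0 < l / 2" using l by simp
    show "varphi \<psi> (phi \<psi> z) = z" if "\<bar>z - l\<bar> \<le> l / 2" for z
      using pos[OF that] by (rule varphi_phi)
    show "isCont (phi \<psi>) z" if "\<bar>z - l\<bar> \<le> l / 2" for z
      using pos[OF that] by (rule isCont_phi)
  qed
  then show ?thesis using l by simp
qed

lemma DERIV_varphi:
  assumes t: "0 < t" shows "(varphi \<psi> has_real_derivative - \<psi> (varphi \<psi> t)) (at t)"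
proof -
  have "(varphi \<psi> has_real_derivative inverse (- (1 / \<psi> (varphi \<psi> t)))) (at t)"
  proof (rule DERIV_inverse_function)
    show "DERIV (phi \<psi>) (varphi \<psi> t) :> - (1 / \<psi> (varphi \<psi> t))"
      by (intro DERIV_phi varphi_pos t)
    show "- (1 / \<psi> (varphi \<psi> t)) \<noteq> 0"
      using psi_pos[OF varphi_pos[OF t]] by simp
    show "0 < t" "t < t + 1" using t by auto
  qed (auto intro: phi_varphi isCont_varphi t)
  then show ?thesis by simp
qed

lemma varphi_tendsto_0: "filterlim (varphi \<psi>) (at_right 0) at_top"
  unfolding filterlim_at
proof
  have pos: "eventually (\<lambda>t. 0 < varphi \<psi> t) at_top"
    by (rule eventually_mono[OF eventually_gt_at_top[of 0]]) (rule varphi_pos)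
  then show "eventually (\<lambda>t. varphi \<psi> t \<in> {0<..} \<and> varphi \<psi> t \<noteq> 0) at_top"
    by (rule eventually_mono) simp
  show "(varphi \<psi> \<longlongrightarrow> 0) at_top"
  proof (rule order_tendstoI)
    fix e :: real assume "e < 0"
    show "eventually (\<lambda>t. e < varphi \<psi> t) at_top"
      using pos by (rule eventually_mono) (use \<open>e < 0\<close> in simp)
  next
    fix e :: real assume e: "0 < e"
    show "eventually (\<lambda>t. varphi \<psi> t < e) at_top"
    proof (rule eventually_mono[OF eventually_gt_at_top[of "phi \<psi> e"]])
      fix t assume "phi \<psi> e < t"
      then show "varphi \<psi> t < e"
        using varphi_strict_anti[of "phi \<psi> e" t] e by (simp add: phi_pos varphi_phi)
    qed
  qed
qed

text \<open>
  The logarithm of \<^term>\<open>varphi \<psi>\<close> has derivative \<open>- \<psi>(y)/y\<close> at \<open>y\<close> = \<^term>\<open>varphi \<psi> t\<close>, and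
  this tends to \<open>- \<alpha>\<close> because \<open>y\<close> tends to 0.
\<close>

lemma varphi_shift_ratio:
  "((\<lambda>t. varphi \<psi> (t + c) / varphi \<psi> t) \<longlongrightarrow> exp (- \<alpha> * c)) at_top"
proof -
  have "((\<lambda>t. ln (varphi \<psi> (t + c)) - ln (varphi \<psi> t)) \<longlongrightarrow> c * (- \<alpha>)) at_top"
  proof (rule increment_tendsto_at_top[where f' = "\<lambda>t. - (\<psi> (varphi \<psi> t) / varphi \<psi> t)"])
    fix t :: real assume t: "0 < t"
    then show "((\<lambda>t. ln (varphi \<psi> t)) has_real_derivative - (\<psi> (varphi \<psi> t) / varphi \<psi> t)) (at t)"
      using varphi_pos[OF t] by (auto intro!: derivative_eq_intros DERIV_varphi)
  next
    show "((\<lambda>t. - (\<psi> (varphi \<psi> t) / varphi \<psi> t)) \<longlongrightarrow> - \<alpha>) at_top"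
      by (intro tendsto_minus filterlim_compose[OF psi_div_tendsto_alpha] varphi_tendsto_0)
  qed
  then have "((\<lambda>t. exp (ln (varphi \<psi> (t + c)) - ln (varphi \<psi> t))) \<longlongrightarrow> exp (c * (- \<alpha>))) at_top"
    by (intro tendsto_intros)
  then have "((\<lambda>t. varphi \<psi> (t + c) / varphi \<psi> t) \<longlongrightarrow> exp (c * (- \<alpha>))) at_top"
  proof (rule Lim_transform_eventually)
    show "eventually (\<lambda>t. exp (ln (varphi \<psi> (t + c)) - ln (varphi \<psi> t)) = varphi \<psi> (t + c) / varphi \<psi> t) at_top"
    proof (rule eventually_mono[OF eventually_gt_at_top[of "\<bar>c\<bar>"]])
      fix t assume "\<bar>c\<bar> < t"
      then have "0 < varphi \<psi> (t + c)" "0 < varphi \<psi> t" by (auto intro!: varphi_pos)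
      then show "exp (ln (varphi \<psi> (t + c)) - ln (varphi \<psi> t)) = varphi \<psi> (t + c) / varphi \<psi> t"
        by (simp add: exp_diff)
    qed
  qed
  then show ?thesis by (simp add: mult.commute)
qed

text \<open>
  For \<open>\<alpha> > 0\<close> the function \<open>\<psi>\<close> is asymptotically linear at 0, and the ratio is that of the
  arguments. For \<open>\<alpha> = 0\<close> the ratio of the arguments tends to 1, and then so does that of the values.
\<close>

lemma psi_varphi_shift_ratio:
  "((\<lambda>t. \<psi> (varphi \<psi> (t + c)) / \<psi> (varphi \<psi> t)) \<longlongrightarrow> exp (- \<alpha> * c)) at_top"
proof -
  note shift = filterlim_add_const_at_top[of c]
  have ev: "eventually (\<lambda>t. 0 < varphi \<psi> (t + c) \<and> 0 < varphi \<psi> t) at_top"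
    by (rule eventually_mono[OF eventually_gt_at_top[of "\<bar>c\<bar>"]]) (auto intro!: varphi_pos)
  show ?thesis
  proof (cases "\<alpha> = 0")
    case True
    then show ?thesis
      using varphi_shift_ratio[of c] by (simp add: psi_ratio_tendsto_1 ev)
  next
    case False
    let ?k = "\<lambda>t. \<psi> (varphi \<psi> t) / varphi \<psi> t"
    have k: "(?k \<longlongrightarrow> \<alpha>) at_top"
      by (intro filterlim_compose[OF psi_div_tendsto_alpha] varphi_tendsto_0)
    then have "((\<lambda>t. ?k (t + c)) \<longlongrightarrow> \<alpha>) at_top"
      by (rule filterlim_compose[OF _ shift])
    then have "((\<lambda>t. ?k (t + c) / ?k t * (varphi \<psi> (t + c) / varphi \<psi> t)) \<longlongrightarrow>
        \<alpha> / \<alpha> * exp (- \<alpha> * c)) at_top"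
      by (intro tendsto_intros varphi_shift_ratio k False)
    then have "((\<lambda>t. ?k (t + c) / ?k t * (varphi \<psi> (t + c) / varphi \<psi> t)) \<longlongrightarrow> exp (- \<alpha> * c)) at_top"
      using False by simp
    then show ?thesis
      by (rule Lim_transform_eventually) (use ev in \<open>auto elim!: eventually_mono\<close>)
  qed
qed

end

section \<open>Extinction probabilities of the process\<close>

locale cb_branching = branching_mechanism \<alpha> \<sigma> \<pi> \<psi> + cb_process \<Omega> F \<psi> u P Z
  for \<alpha> \<sigma> :: real and \<pi> :: "real measure" and \<psi> :: "real \<Rightarrow> real"
    and \<Omega> :: "'w set" and F :: "ennreal \<Rightarrow> 'w measure"
    and u :: "real \<Rightarrow> real \<Rightarrow> real"
    and P :: "real \<Rightarrow> 'w measure" and Z :: "real \<Rightarrow> 'w \<Rightarrow> real"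
begin

lemma u_continuous: "0 < l \<Longrightarrow> 0 \<le> a \<Longrightarrow> continuous_on {a..b} (\<lambda>s. u s l)"
  by (rule continuous_on_subset[of "{0..}"])
     (auto simp: continuous_on_eq_continuous_within intro: DERIV_continuous u_ode)

lemma DERIV_u:
  assumes "0 < l" "0 < t" shows "((\<lambda>s. u s l) has_real_derivative - \<psi> (u t l)) (at t)"
proof -
  have "at t within {0..} = at t" using assms by (intro at_within_interior) auto
  then show ?thesis using u_ode[of t l] assms by simp
qed

lemma u_le:
  assumes "0 < l" "0 \<le> t" shows "u t l \<le> l"
proof -
  have "u t l \<le> u 0 l"
  proof (rule DERIV_nonpos_imp_decreasing_open[OF assms(2)])
    fix x assume x: "0 < x" "x < t"
    show "\<exists>y. ((\<lambda>s. u s l) has_real_derivative y) (at x) \<and> y \<le> 0"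
      using DERIV_u[OF assms(1) x(1)] psi_nonneg u_nonneg[of x l] x assms
      by (intro exI[where x = "- \<psi> (u x l)"]) simp
  qed (use u_continuous assms in simp)
  then show ?thesis using u_0 assms by simp
qed

text \<open>
  Positivity is needed because \<open>\<phi>\<close> is meaningful on \<open>(0, \<infinity>)\<close> only. As \<open>u\<close> does not exceed \<open>l\<close>,
  it decays at most exponentially, at rate \<open>\<psi>(l)/l\<close>.
\<close>

lemma u_pos:
  assumes l: "0 < l" and t: "0 \<le> t" shows "0 < u t l"
proof -
  define K where "K = \<psi> l / l"
  have "u 0 l * exp (K * 0) \<le> u t l * exp (K * t)"
  proof (rule DERIV_nonneg_imp_increasing_open[OF t])
    fix x assume x: "0 < x" "x < t"
    have "((\<lambda>s. u s l * exp (K * s)) has_real_derivative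
        (K * u x l - \<psi> (u x l)) * exp (K * x)) (at x)"
      using DERIV_u[OF l x(1)] by (auto intro!: derivative_eq_intros simp: algebra_simps)
    moreover have "\<psi> (u x l) \<le> K * u x l"
    proof (cases "u x l = 0")
      case True
      then show ?thesis by (simp add: psi_0)
    next
      case False
      then have "0 < u x l" using u_nonneg[of x l] l x by simp
      then show ?thesis
        using psi_div_mono[of "u x l" l] u_le[of l x] l x by (simp add: K_def field_simps)
    qed
    ultimately show "\<exists>y. ((\<lambda>s. u s l * exp (K * s)) has_real_derivative y) (at x) \<and> 0 \<le> y"
      by (intro exI[where x = "(K * u x l - \<psi> (u x l)) * exp (K * x)"]) simp
  next
    show "continuous_on {0..t} (\<lambda>s. u s l * exp (K * s))"
      by (intro continuous_intros u_continuous l) auto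
  qed
  then have "l \<le> u t l * exp (K * t)" using u_0[OF l] by simp
  then have "0 < u t l * exp (K * t)" using l by linarith
  then show ?thesis by (simp add: zero_less_mult_iff)
qed

text \<open>
  Along the flow, \<open>\<phi>(u)\<close> has derivative \<open>(- 1/\<psi>(u)) (- \<psi>(u)) = 1\<close>.
\<close>

lemma u_eq_varphi:
  assumes l: "0 < l" and t: "0 \<le> t" shows "u t l = varphi \<psi> (t + phi \<psi> l)"
proof -
  have "phi \<psi> (u t l) - t = phi \<psi> (u 0 l) - 0"
  proof (cases "t = 0")
    case False
    with t have "0 < t" by simp
    then show ?thesis
    proof (rule DERIV_isconst_end[where f = "\<lambda>s. phi \<psi> (u s l) - s"])
      fix x assume x: "0 < x" "x < t"
      have pos: "0 < u x l" using l x by (intro u_pos) auto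
      have "((\<lambda>s. phi \<psi> (u s l)) has_real_derivative - (1 / \<psi> (u x l)) * - \<psi> (u x l)) (at x)"
        by (rule DERIV_chain2[OF DERIV_phi[OF pos] DERIV_u[OF l x(1)]])
      then show "((\<lambda>s. phi \<psi> (u s l) - s) has_real_derivative 0) (at x)"
        using psi_pos[OF pos] by (auto intro!: derivative_eq_intros)
    next
      have "continuous_on {0..t} (\<lambda>s. phi \<psi> (u s l))"
      proof (rule continuous_on_compose2[where g = "phi \<psi>" and f = "\<lambda>s. u s l"])
        show "continuous_on {0<..} (phi \<psi>)"
          by (intro continuous_at_imp_continuous_on ballI isCont_phi) simp
      qed (use l u_pos u_continuous in auto)
      then show "continuous_on {0..t} (\<lambda>s. phi \<psi> (u s l) - s)"
        by (intro continuous_intros)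
    qed
  qed simp
  then have "phi \<psi> (u t l) = t + phi \<psi> l" using u_0[OF l] by simp
  then show ?thesis using varphi_phi[OF u_pos[OF l t]] by simp
qed

lemma space_P: "0 \<le> x \<Longrightarrow> space (P x) = \<Omega>"
  using sets_eq_imp_space_eq[OF sets_P] space_F by simp

lemma measurable_Z:
  assumes "0 \<le> x" "0 \<le> t" shows "Z t \<in> borel_measurable (P x)"
proof -
  have "Z t \<in> borel_measurable (F \<infinity>)"
    by (rule measurable_from_subalg[OF _ adapted[OF assms(2)]])
       (use sets_F_mono[of "ennreal t" \<infinity>] in \<open>auto simp: subalgebra_def space_F\<close>)
  then show ?thesis
    using measurable_cong_sets[OF sets_P[OF assms(1)] refl] by blast
qed

text \<open>
  Since \<open>exp (- n Z\<^sub>t)\<close> decreases to the indicator of \<open>Z\<^sub>t = 0\<close>, the probability is the limit of the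
  Laplace transform at \<open>n\<close>, and \<open>\<phi>(n) \<rightarrow> 0\<close>.
\<close>

lemma prob_extinct:
  assumes x: "0 \<le> x" and t: "0 < t"
  shows "measure (P x) {\<omega> \<in> \<Omega>. Z t \<omega> = 0} = exp (- (x * varphi \<psi> t))"
proof -
  interpret prob_space "P x" using x by (rule prob_space_P)
  have [measurable]: "Z t \<in> borel_measurable (P x)" using x t by (intro measurable_Z) auto
  have lim1: "(\<lambda>n. LINT \<omega>|P x. exp (- real (Suc n) * Z t \<omega>)) \<longlonglongrightarrow>
      (LINT \<omega>|P x. indicator {\<omega> \<in> \<Omega>. Z t \<omega> = 0} \<omega>)"
  proof (rule integral_dominated_convergence[where w = "\<lambda>_. 1"])
    show "AE \<omega> in P x. (\<lambda>n. exp (- real (Suc n) * Z t \<omega>)) \<longlonglongrightarrow> indicator {\<omega> \<in> \<Omega>. Z t \<omega> = 0} \<omega>"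
    proof (rule AE_I2)
      fix \<omega> assume \<omega>: "\<omega> \<in> space (P x)"
      then have "0 \<le> Z t \<omega>" using x t by (simp add: space_P Z_nonneg)
      then consider "Z t \<omega> = 0" | "0 < Z t \<omega>" by linarith
      then show "(\<lambda>n. exp (- real (Suc n) * Z t \<omega>)) \<longlonglongrightarrow> indicator {\<omega> \<in> \<Omega>. Z t \<omega> = 0} \<omega>"
      proof cases
        case 1
        then show ?thesis using \<omega> x by (simp add: space_P)
      next
        case 2
        then have "(\<lambda>n. exp (- real (Suc n) * Z t \<omega>)) \<longlonglongrightarrow> 0" by real_asymp
        then show ?thesis using 2 by simp
      qed
    qed
    show "AE \<omega> in P x. norm (exp (- real (Suc n) * Z t \<omega>)) \<le> 1" for n
    proof (rule AE_I2)
      fix \<omega> assume "\<omega> \<in> space (P x)"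
      then have "0 \<le> real (Suc n) * Z t \<omega>"
        using x t by (intro mult_nonneg_nonneg) (auto simp: space_P Z_nonneg)
      then have "- real (Suc n) * Z t \<omega> \<le> 0" by linarith
      then show "norm (exp (- real (Suc n) * Z t \<omega>)) \<le> 1"
        unfolding real_norm_def abs_exp_cancel exp_le_one_iff .
    qed
    show "indicator {\<omega> \<in> \<Omega>. Z t \<omega> = 0} \<in> borel_measurable (P x)"
      unfolding space_P[OF x, symmetric] by measurable
  qed auto
  have prob: "(LINT \<omega>|P x. indicator {\<omega> \<in> \<Omega>. Z t \<omega> = 0} \<omega>) = measure (P x) {\<omega> \<in> \<Omega>. Z t \<omega> = 0}"
    unfolding space_P[OF x, symmetric] by simp
  have lim2: "(\<lambda>n. LINT \<omega>|P x. exp (- real (Suc n) * Z t \<omega>)) \<longlonglongrightarrow> exp (- (x * varphi \<psi> t))"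
  proof -
    have "filterlim (\<lambda>n. real (Suc n)) at_top sequentially" by real_asymp
    then have "(\<lambda>n. phi \<psi> (real (Suc n))) \<longlonglongrightarrow> 0"
      by (rule filterlim_compose[OF phi_tendsto_0])
    then have "(\<lambda>n. t + phi \<psi> (real (Suc n))) \<longlonglongrightarrow> t + 0"
      by (intro tendsto_intros)
    then have "(\<lambda>n. varphi \<psi> (t + phi \<psi> (real (Suc n)))) \<longlonglongrightarrow> varphi \<psi> t"
      using t by (intro isCont_tendsto_compose[OF isCont_varphi]) auto
    then have "(\<lambda>n. exp (- x * varphi \<psi> (t + phi \<psi> (real (Suc n))))) \<longlonglongrightarrow> exp (- x * varphi \<psi> t)"
      by (intro tendsto_intros)
    moreover have "(LINT \<omega>|P x. exp (- real (Suc n) * Z t \<omega>)) = exp (- x * varphi \<psi> (t + phi \<psi> (real (Suc n))))" for n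
      using x t laplace_Z[of x t "real (Suc n)"] u_eq_varphi[of "real (Suc n)" t] by simp
    ultimately show ?thesis by simp
  qed
  show ?thesis using LIMSEQ_unique[OF lim1 lim2] unfolding prob .
qed

text \<open>
  The strong Markov property at the constant time \<open>r\<close>: from the state \<open>Z\<^sub>r\<close>, extinction within the
  next \<open>t\<close> time units has the exponential probability just computed.
\<close>

lemma prob_extinct_later:
  assumes x: "0 \<le> x" and r: "0 \<le> r" and t: "0 < t" and A: "A \<in> sets borel"
  shows "measure (P x) {\<omega> \<in> \<Omega>. Z r \<omega> \<in> A \<and> Z (r + t) \<omega> = 0} =
    (LINT \<omega>|P x. indicator A (Z r \<omega>) * exp (- (varphi \<psi> t * Z r \<omega>)))"
proof -
  interpret prob_space "P x" using x by (rule prob_space_P)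
  have [measurable]: "Z r \<in> borel_measurable (P x)" "A \<in> sets borel" using x r A by (auto intro: measurable_Z)
  let ?A = "{\<omega> \<in> \<Omega>. Z r \<omega> \<in> A}"
  have "?A \<in> sets (F (ennreal r))"
    using measurable_sets[OF adapted[OF r] A] by (simp add: space_F vimage_def Int_def conj_commute)
  then have A_pre: "?A \<in> sets (pre_sigma (\<lambda>_. ennreal r))"
  proof (intro sets_pre_sigmaI stopping_time_const)
    fix t
    show "{\<omega> \<in> ?A. ennreal r \<le> t} \<in> sets (F t)"
      using \<open>?A \<in> sets (F (ennreal r))\<close> sets_F_mono[of "ennreal r" t]
      by (cases "ennreal r \<le> t") auto
  qed
  have "emeasure (P x) {\<omega> \<in> \<Omega>. Z r \<omega> \<in> A \<and> Z (r + t) \<omega> = 0} =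
      emeasure (P x) {\<omega> \<in> ?A. ennreal r < \<infinity> \<and> Z (enn2real (ennreal r) + t) \<omega> \<in> {0}}"
    using r by (intro arg_cong[where f = "emeasure (P x)"]) auto
  also have "\<dots> = (\<integral>\<^sup>+\<omega>\<in>{\<omega> \<in> ?A. ennreal r < \<infinity>}.
      emeasure (P (Z (enn2real (ennreal r)) \<omega>)) {\<omega>' \<in> \<Omega>. Z t \<omega>' \<in> {0}} \<partial>P x)"
    using x t A_pre by (intro strong_markov stopping_time_const) auto
  also have "\<dots> = (\<integral>\<^sup>+\<omega>. ennreal (indicator A (Z r \<omega>) * exp (- (varphi \<psi> t * Z r \<omega>))) \<partial>P x)"
  proof (rule nn_integral_cong)
    fix \<omega> assume "\<omega> \<in> space (P x)"
    then have \<omega>: "\<omega> \<in> \<Omega>" and nn: "0 \<le> Z r \<omega>" using x r by (simp_all add: space_P Z_nonneg)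
    interpret Q: prob_space "P (Z r \<omega>)" using nn by (rule prob_space_P)
    have "emeasure (P (Z r \<omega>)) {\<omega>' \<in> \<Omega>. Z t \<omega>' \<in> {0}} = ennreal (exp (- (varphi \<psi> t * Z r \<omega>)))"
      using prob_extinct[OF nn t] by (simp add: Q.emeasure_eq_measure mult.commute)
    then show "emeasure (P (Z (enn2real (ennreal r)) \<omega>)) {\<omega>' \<in> \<Omega>. Z t \<omega>' \<in> {0}} *
        indicator {\<omega> \<in> ?A. ennreal r < \<infinity>} \<omega> =
        ennreal (indicator A (Z r \<omega>) * exp (- (varphi \<psi> t * Z r \<omega>)))"
      using r \<omega> by (simp add: indicator_def)
  qed
  also have "\<dots> = ennreal (LINT \<omega>|P x. indicator A (Z r \<omega>) * exp (- (varphi \<psi> t * Z r \<omega>)))"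
  proof (rule nn_integral_eq_integral)
    show "integrable (P x) (\<lambda>\<omega>. indicator A (Z r \<omega>) * exp (- (varphi \<psi> t * Z r \<omega>)))"
      using x r t varphi_pos[of t]
      by (intro integrable_const_bound[where B = 1] AE_I2)
         (auto simp: space_P Z_nonneg indicator_def)
  qed simp
  finally show ?thesis
    by (simp add: emeasure_eq_measure integral_nonneg_AE)
qed

lemma Z_eq_0_if_extinct:
  assumes "\<omega> \<in> \<Omega>" "0 < t" "extinction_time Z \<omega> < ennreal t"
  shows "\<exists>s. 0 < s \<and> s < t \<and> Z s \<omega> = 0"
  using assms by (auto simp: extinction_time_def Inf_less_iff ennreal_less_iff)

lemma extinct_if_Z_eq_0:
  assumes "0 < s" "s < t" "Z s \<omega> = 0"
  shows "extinction_time Z \<omega> < ennreal t"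
  using assms by (auto simp: extinction_time_def Inf_less_iff ennreal_less_iff)

text \<open>
  The event \<open>\<zeta> < t\<close> is the increasing union of the events that the process vanishes at times
  \<open>r + d n\<close> increasing to \<open>t\<close>; this gives its measurability, and continuity of
  \<^term>\<open>varphi \<psi>\<close> gives its probability.
\<close>

lemma prob_extinction_before:
  assumes x: "0 \<le> x" and r: "0 \<le> r" and t: "r < t" and A: "A \<in> sets borel"
  shows "{\<omega> \<in> \<Omega>. Z r \<omega> \<in> A \<and> extinction_time Z \<omega> < ennreal t} \<in> sets (P x)"
    and "measure (P x) {\<omega> \<in> \<Omega>. Z r \<omega> \<in> A \<and> extinction_time Z \<omega> < ennreal t} =
      (LINT \<omega>|P x. indicator A (Z r \<omega>) * exp (- (varphi \<psi> (t - r) * Z r \<omega>)))"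
proof -
  interpret prob_space "P x" using x by (rule prob_space_P)
  have [measurable]: "Z r \<in> borel_measurable (P x)" "A \<in> sets borel" using x r A by (auto intro: measurable_Z)
  \<comment> \<open>The denominator \<open>n + 2\<close> keeps \<open>d n\<close> positive also for \<open>n = 0\<close>.\<close>
  define d where "d n = (t - r) - (t - r) / (real n + 2)" for n
  have d_pos: "0 < d n" and d_less: "d n < t - r" for n
  proof -
    have "0 < (t - r) / (real n + 2)" "(t - r) / (real n + 2) < (t - r) / 1"
      using t divide_strict_left_mono[of 1 "real n + 2" "t - r"] by auto
    then show "0 < d n" "d n < t - r" by (auto simp: d_def)
  qed
  have d_mono: "d m \<le> d n" if "m \<le> n" for m n
    using that t by (auto simp: d_def intro!: divide_left_mono)
  have d_lim: "d \<longlonglongrightarrow> t - r" unfolding d_def by real_asymp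
  let ?E = "\<lambda>n. {\<omega> \<in> \<Omega>. Z r \<omega> \<in> A \<and> Z (r + d n) \<omega> = 0}"
  have E_sets: "?E n \<in> sets (P x)" for n
  proof -
    have [measurable]: "Z (r + d n) \<in> borel_measurable (P x)"
      using x r d_pos[of n] by (intro measurable_Z) auto
    show ?thesis unfolding space_P[OF x, symmetric] by measurable
  qed
  have eq: "{\<omega> \<in> \<Omega>. Z r \<omega> \<in> A \<and> extinction_time Z \<omega> < ennreal t} = (\<Union>n. ?E n)"
  proof (intro equalityI subsetI)
    fix \<omega> assume *: "\<omega> \<in> {\<omega> \<in> \<Omega>. Z r \<omega> \<in> A \<and> extinction_time Z \<omega> < ennreal t}"
    then obtain s where s: "0 < s" "s < t" "Z s \<omega> = 0"
      using Z_eq_0_if_extinct[of \<omega> t] r t by auto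
    have "eventually (\<lambda>n. s - r < d n) sequentially"
      using s by (intro order_tendstoD(1)[OF d_lim]) simp
    then obtain n where "s - r < d n" by (auto simp: eventually_sequentially)
    then have "Z (r + d n) \<omega> = 0"
      using * s by (intro absorbed[of s "r + d n" \<omega>]) auto
    then show "\<omega> \<in> (\<Union>n. ?E n)" using * by auto
  next
    fix \<omega> assume "\<omega> \<in> (\<Union>n. ?E n)"
    then obtain n where "\<omega> \<in> ?E n" by blast
    then show "\<omega> \<in> {\<omega> \<in> \<Omega>. Z r \<omega> \<in> A \<and> extinction_time Z \<omega> < ennreal t}"
      using extinct_if_Z_eq_0[of "r + d n" t \<omega>] r d_pos[of n] d_less[of n] by auto
  qed
  show "{\<omega> \<in> \<Omega>. Z r \<omega> \<in> A \<and> extinction_time Z \<omega> < ennreal t} \<in> sets (P x)"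
    unfolding eq using E_sets by auto
  have "(\<lambda>n. measure (P x) (?E n)) \<longlonglongrightarrow> measure (P x) (\<Union>n. ?E n)"
  proof (rule finite_Lim_measure_incseq)
    show "incseq ?E"
    proof (rule monoI, rule subsetI)
      fix m n \<omega> assume "m \<le> (n::nat)" "\<omega> \<in> ?E m"
      then show "\<omega> \<in> ?E n"
        using absorbed[of "r + d m" "r + d n" \<omega>] r d_pos[of m] d_mono[of m n] by auto
    qed
  qed (use E_sets in auto)
  moreover have "(\<lambda>n. measure (P x) (?E n)) \<longlonglongrightarrow>
      (LINT \<omega>|P x. indicator A (Z r \<omega>) * exp (- (varphi \<psi> (t - r) * Z r \<omega>)))"
    unfolding prob_extinct_later[OF x r d_pos A]
  proof (rule integral_dominated_convergence[where w = "\<lambda>_. 1"])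
    have "(\<lambda>n. varphi \<psi> (d n)) \<longlonglongrightarrow> varphi \<psi> (t - r)"
      using t by (intro isCont_tendsto_compose[OF isCont_varphi d_lim]) simp
    then show "AE \<omega> in P x. (\<lambda>n. indicator A (Z r \<omega>) * exp (- (varphi \<psi> (d n) * Z r \<omega>)))
        \<longlonglongrightarrow> indicator A (Z r \<omega>) * exp (- (varphi \<psi> (t - r) * Z r \<omega>))"
      by (intro AE_I2 tendsto_intros)
    show "AE \<omega> in P x. norm (indicator A (Z r \<omega>) * exp (- (varphi \<psi> (d n) * Z r \<omega>))) \<le> 1" for n
      using x r varphi_pos[OF d_pos[of n]] by (intro AE_I2) (auto simp: space_P Z_nonneg indicator_def)
  qed auto
  ultimately show "measure (P x) {\<omega> \<in> \<Omega>. Z r \<omega> \<in> A \<and> extinction_time Z \<omega> < ennreal t} =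
      (LINT \<omega>|P x. indicator A (Z r \<omega>) * exp (- (varphi \<psi> (t - r) * Z r \<omega>)))"
    unfolding eq by (rule LIMSEQ_unique)
qed

section \<open>Conditioning on extinction at a fixed time\<close>

text \<open>
  Both sides are the left derivative at \<open>v\<close> of \<open>w \<mapsto> - E\<^sub>x[exp (- w Z\<^sub>r)]\<close>: the left side by
  dominated convergence, the right side by the chain rule applied to the explicit transform.
\<close>

lemma size_biased_expectation:
  assumes x: "0 \<le> x" and r: "0 \<le> r" and v: "0 < v"
  shows "(LINT \<omega>|P x. Z r \<omega> * exp (- (v * Z r \<omega>))) =
    x * (\<psi> (varphi \<psi> (r + phi \<psi> v)) / \<psi> v) * exp (- (x * varphi \<psi> (r + phi \<psi> v)))"
    (is "_ = ?D")
proof -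
  have [measurable]: "Z r \<in> borel_measurable (P x)" using x r by (intro measurable_Z) auto
  let ?L = "\<lambda>w. exp (- (x * varphi \<psi> (r + phi \<psi> w)))"
  have L: "(LINT \<omega>|P x. exp (- (w * Z r \<omega>))) = ?L w" if "0 < w" for w
    using laplace_Z[OF x r that] u_eq_varphi[OF that r] by simp
  have "((\<lambda>w. ((LINT \<omega>|P x. indicator UNIV (Z r \<omega>) * exp (- (w * Z r \<omega>))) -
              (LINT \<omega>|P x. indicator UNIV (Z r \<omega>) * exp (- (v * Z r \<omega>)))) / (v - w))
          \<longlongrightarrow> (LINT \<omega>|P x. indicator UNIV (Z r \<omega>) * (Z r \<omega> * exp (- (v * Z r \<omega>))))) (at_left v)"
    by (rule laplace_left_derivative) (use x r v prob_space_P Z_nonneg in \<open>auto simp: space_P\<close>)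
  then have 1: "((\<lambda>w. ((LINT \<omega>|P x. exp (- (w * Z r \<omega>))) - (LINT \<omega>|P x. exp (- (v * Z r \<omega>)))) / (v - w))
          \<longlongrightarrow> (LINT \<omega>|P x. Z r \<omega> * exp (- (v * Z r \<omega>)))) (at_left v)"
    by simp
  have "0 < r + phi \<psi> v" using r phi_pos[OF v] by simp
  moreover have "((\<lambda>w. r + phi \<psi> w) has_real_derivative - (1 / \<psi> v)) (at v)"
    using DERIV_phi[OF v] by (auto intro!: derivative_eq_intros)
  ultimately have "((\<lambda>w. varphi \<psi> (r + phi \<psi> w)) has_real_derivative
      - \<psi> (varphi \<psi> (r + phi \<psi> v)) * - (1 / \<psi> v)) (at v)"
    by (intro DERIV_chain2[where f = "varphi \<psi>" and g = "\<lambda>w. r + phi \<psi> w"] DERIV_varphi)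
  then have "(?L has_real_derivative exp (- (x * varphi \<psi> (r + phi \<psi> v))) *
      - (x * (- \<psi> (varphi \<psi> (r + phi \<psi> v)) * - (1 / \<psi> v)))) (at v)"
    by (intro DERIV_fun_exp DERIV_minus DERIV_cmult)
  then have "(?L has_real_derivative - ?D) (at v)"
    by (simp add: mult_ac)
  then have "((\<lambda>w. (?L w - ?L v) / (w - v)) \<longlongrightarrow> - ?D) (at v)"
    by (simp add: has_field_derivative_iff)
  then have lim: "((\<lambda>w. - ((?L w - ?L v) / (w - v))) \<longlongrightarrow> - (- ?D)) (at_left v)"
    by (intro tendsto_minus) (rule filterlim_mono[OF _ order_refl at_le], auto)
  have neg: "- (a / (w - v)) = a / (v - w)" for a w :: real
    by (simp add: minus_divide_right)
  have "eventually (\<lambda>w. - ((?L w - ?L v) / (w - v)) =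
      ((LINT \<omega>|P x. exp (- (w * Z r \<omega>))) - (LINT \<omega>|P x. exp (- (v * Z r \<omega>)))) / (v - w)) (at_left v)"
    by (rule eventually_mono[OF eventually_at_left_real[OF v]]) (unfold neg, use L v in simp)
  then have "((\<lambda>w. ((LINT \<omega>|P x. exp (- (w * Z r \<omega>))) - (LINT \<omega>|P x. exp (- (v * Z r \<omega>)))) / (v - w))
          \<longlongrightarrow> - (- ?D)) (at_left v)"
    by (rule Lim_transform_eventually[OF lim])
  from tendsto_unique[OF _ 1 this] show ?thesis by simp
qed

lemma size_biased_expectation_pos:
  assumes "0 < x" "0 \<le> r" "0 < v"
  shows "0 < (LINT \<omega>|P x. Z r \<omega> * exp (- (v * Z r \<omega>)))"
proof -
  have "0 < varphi \<psi> (r + phi \<psi> v)"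
    using assms phi_pos[of v] by (intro varphi_pos) simp
  then show ?thesis
    using assms psi_pos[of v] psi_pos[of "varphi \<psi> (r + phi \<psi> v)"]
    by (subst size_biased_expectation) auto
qed

definition size_biased_law :: "real \<Rightarrow> real \<Rightarrow> real \<Rightarrow> 'w measure" where
  "size_biased_law x r v = density (P x) (\<lambda>\<omega>. ennreal
     (Z r \<omega> * exp (- (v * Z r \<omega>)) / (LINT \<omega>|P x. Z r \<omega> * exp (- (v * Z r \<omega>)))))"

lemma integral_size_biased_law:
  fixes f :: "real \<Rightarrow> real"
  assumes x: "0 < x" and r: "0 \<le> r" and v: "0 < v" and f: "f \<in> borel_measurable borel"
  shows "(LINT \<omega>|size_biased_law x r v. f (Z r \<omega>)) =
    (LINT \<omega>|P x. f (Z r \<omega>) * (Z r \<omega> * exp (- (v * Z r \<omega>)))) /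
    (LINT \<omega>|P x. Z r \<omega> * exp (- (v * Z r \<omega>)))"
proof -
  have [measurable]: "Z r \<in> borel_measurable (P x)" "f \<in> borel_measurable borel"
    using x r f by (auto intro: measurable_Z)
  have "(LINT \<omega>|size_biased_law x r v. f (Z r \<omega>)) =
      (LINT \<omega>|P x. (Z r \<omega> * exp (- (v * Z r \<omega>)) /
        (LINT \<omega>|P x. Z r \<omega> * exp (- (v * Z r \<omega>)))) *\<^sub>R f (Z r \<omega>))"
    unfolding size_biased_law_def using size_biased_expectation_pos[OF x r v] x r
    by (intro integral_density) (auto intro!: AE_I2 divide_nonneg_pos simp: space_P Z_nonneg)
  also have "\<dots> = (LINT \<omega>|P x. f (Z r \<omega>) * (Z r \<omega> * exp (- (v * Z r \<omega>))) /
        (LINT \<omega>|P x. Z r \<omega> * exp (- (v * Z r \<omega>))))"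
    by (simp add: mult_ac)
  finally show ?thesis by simp
qed

lemma laplace_size_biased_law:
  assumes x: "0 < x" and r: "0 \<le> r" and v: "0 < v"
  shows "(LINT \<omega>|size_biased_law x r v. exp (- l * Z r \<omega>)) =
    (LINT \<omega>|P x. Z r \<omega> * exp (- ((l + v) * Z r \<omega>))) /
    (LINT \<omega>|P x. Z r \<omega> * exp (- (v * Z r \<omega>)))"
proof -
  have eq: "exp (- l * z) * (z * exp (- (v * z))) = z * exp (- ((l + v) * z))" for z :: real
    by (simp add: algebra_simps flip: exp_add)
  have "(\<lambda>z. exp (- l * z)) \<in> borel_measurable borel" by measurable
  from integral_size_biased_law[OF x r v this] show ?thesis unfolding eq .
qed

lemma prob_space_size_biased_law:
  assumes x: "0 < x" and r: "0 \<le> r" and v: "0 < v"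
  shows "prob_space (size_biased_law x r v)"
proof
  let ?m = "LINT \<omega>|P x. Z r \<omega> * exp (- (v * Z r \<omega>))"
  have [measurable]: "Z r \<in> borel_measurable (P x)" using x r by (auto intro: measurable_Z)
  have m: "0 < ?m" using assms by (rule size_biased_expectation_pos)
  have int: "integrable (P x) (\<lambda>\<omega>. Z r \<omega> * exp (- (v * Z r \<omega>)))"
    using laplace_left_derivative(1)[of "P x" "Z r" UNIV v] x r v prob_space_P Z_nonneg
    by (simp add: space_P)
  have "emeasure (size_biased_law x r v) (space (size_biased_law x r v)) =
      (\<integral>\<^sup>+\<omega>. ennreal (Z r \<omega> * exp (- (v * Z r \<omega>)) / ?m) \<partial>P x)"
    by (simp add: size_biased_law_def emeasure_density cong: nn_integral_cong)
  also have "\<dots> = ennreal (LINT \<omega>|P x. Z r \<omega> * exp (- (v * Z r \<omega>)) / ?m)"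
    using int m x r
    by (intro nn_integral_eq_integral integrable_divide) (auto intro!: AE_I2 simp: space_P Z_nonneg)
  also have "\<dots> = 1" using m by simp
  finally show "emeasure (size_biased_law x r v) (space (size_biased_law x r v)) = 1" .
qed

text \<open>
  Given the state at time \<open>t - q\<close>, extinction falls in \<open>[t, t + s)\<close> with probability
  \<open>exp (- w Z) - exp (- v Z)\<close>, where \<open>w\<close> = \<^term>\<open>varphi \<psi> (q + s)\<close> increases to
  \<open>v\<close> = \<^term>\<open>varphi \<psi> q\<close>. Dividing numerator and denominator by \<open>v - w\<close> leads to left
  derivatives of truncated Laplace transforms.
\<close>

lemma cond_prob_tendsto:
  assumes x: "0 < x" and q: "0 < q" and t: "q < t" and A: "A \<in> sets borel"
  shows "((\<lambda>s. \<P>(\<omega> in P x. Z (t - q) \<omega> \<in> A \<bar>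
            ennreal t \<le> extinction_time Z \<omega> \<and> extinction_time Z \<omega> < ennreal (t + s)))
    \<longlongrightarrow> measure (size_biased_law x (t - q) (varphi \<psi> q)) {\<omega> \<in> \<Omega>. Z (t - q) \<omega> \<in> A}) (at_right 0)"
proof -
  define r where "r = t - q"
  define v where "v = varphi \<psi> q"
  have r: "0 \<le> r" "r < t" "t - r = q" using t q by (auto simp: r_def)
  have v: "0 < v" using q by (simp add: v_def varphi_pos)
  interpret prob_space "P x" using x by (intro prob_space_P) simp
  have [measurable]: "Z r \<in> borel_measurable (P x)" "A \<in> sets borel" using x r A by (auto intro: measurable_Z)
  let ?G = "\<lambda>B w. LINT \<omega>|P x. indicator B (Z r \<omega>) * exp (- (w * Z r \<omega>))"
  let ?D = "\<lambda>B. LINT \<omega>|P x. indicator B (Z r \<omega>) * (Z r \<omega> * exp (- (v * Z r \<omega>)))"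
  have quot: "((\<lambda>w. (?G B w - ?G B v) / (v - w)) \<longlongrightarrow> ?D B) (at_left v)" if "B \<in> sets borel" for B
    by (rule laplace_left_derivative) (use x r v that prob_space_P Z_nonneg in \<open>auto simp: space_P\<close>)
  have window: "measure (P x) {\<omega> \<in> \<Omega>. Z r \<omega> \<in> B \<and> ennreal t \<le> extinction_time Z \<omega> \<and>
      extinction_time Z \<omega> < ennreal (t + s)} = ?G B (varphi \<psi> (q + s)) - ?G B v"
    if s: "0 < s" and B: "B \<in> sets borel" for s B
  proof -
    let ?E = "\<lambda>t. {\<omega> \<in> \<Omega>. Z r \<omega> \<in> B \<and> extinction_time Z \<omega> < ennreal t}"
    have x': "0 \<le> x" using x by simp
    have ts: "r < t + s" "t + s - r = q + s" using r s by auto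
    note E = prob_extinction_before[OF x' r(1,2) B] prob_extinction_before[OF x' r(1) ts(1) B]
    have "{\<omega> \<in> \<Omega>. Z r \<omega> \<in> B \<and> ennreal t \<le> extinction_time Z \<omega> \<and>
        extinction_time Z \<omega> < ennreal (t + s)} = ?E (t + s) - ?E t"
      by (auto simp: not_less)
    moreover have "?E t \<subseteq> ?E (t + s)"
      using s by (auto intro: less_le_trans[OF _ ennreal_leI])
    ultimately show ?thesis
      using E by (simp add: finite_measure_Diff ts r v_def)
  qed
  have "filterlim (\<lambda>s. varphi \<psi> (q + s)) (at_left v) (at_right 0)"
    unfolding filterlim_at
  proof
    show "eventually (\<lambda>s. varphi \<psi> (q + s) \<in> {..<v} \<and> varphi \<psi> (q + s) \<noteq> v) (at_right 0)"
      using eventually_at_right_less[of 0]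
    proof eventually_elim
      case (elim s)
      then show ?case using varphi_strict_anti[of q "q + s"] q by (simp add: v_def)
    qed
    have "((\<lambda>s. q + s) \<longlongrightarrow> q + 0) (at_right 0)" by (intro tendsto_intros)
    then show "((\<lambda>s. varphi \<psi> (q + s)) \<longlongrightarrow> v) (at_right 0)"
      unfolding v_def using q by (intro isCont_tendsto_compose[OF isCont_varphi]) auto
  qed
  note lim = filterlim_compose[OF quot this]
  have D_pos: "0 < ?D UNIV" using size_biased_expectation_pos[OF x r(1) v] by simp
  have "((\<lambda>s. ((?G A (varphi \<psi> (q + s)) - ?G A v) / (v - varphi \<psi> (q + s))) /
      ((?G UNIV (varphi \<psi> (q + s)) - ?G UNIV v) / (v - varphi \<psi> (q + s)))) \<longlongrightarrow> ?D A / ?D UNIV) (at_right 0)"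
    using D_pos A by (intro tendsto_divide lim) auto
  then have "((\<lambda>s. \<P>(\<omega> in P x. Z r \<omega> \<in> A \<bar>
            ennreal t \<le> extinction_time Z \<omega> \<and> extinction_time Z \<omega> < ennreal (t + s)))
    \<longlongrightarrow> ?D A / ?D UNIV) (at_right 0)"
  proof (rule Lim_transform_eventually)
    show "eventually (\<lambda>s. ((?G A (varphi \<psi> (q + s)) - ?G A v) / (v - varphi \<psi> (q + s))) /
      ((?G UNIV (varphi \<psi> (q + s)) - ?G UNIV v) / (v - varphi \<psi> (q + s))) =
      \<P>(\<omega> in P x. Z r \<omega> \<in> A \<bar>
            ennreal t \<le> extinction_time Z \<omega> \<and> extinction_time Z \<omega> < ennreal (t + s))) (at_right 0)"
      using eventually_at_right_less[of 0]
    proof eventually_elim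
      case (elim s)
      then have "varphi \<psi> (q + s) < v" using varphi_strict_anti[of q "q + s"] q by (simp add: v_def)
      then show ?case
        using window[OF elim A] window[OF elim, of UNIV] x
        by (simp add: cond_prob_def space_P)
    qed
  qed
  moreover have "measure (size_biased_law x r v) {\<omega> \<in> \<Omega>. Z r \<omega> \<in> A} = ?D A / ?D UNIV"
  proof -
    interpret S: prob_space "size_biased_law x r v"
      using x r v by (intro prob_space_size_biased_law) auto
    have sp: "space (size_biased_law x r v) = \<Omega>" using x by (simp add: size_biased_law_def space_P)
    have [measurable_cong]: "sets (size_biased_law x r v) = sets (P x)" by (simp add: size_biased_law_def)
    have "measure (size_biased_law x r v) {\<omega> \<in> \<Omega>. Z r \<omega> \<in> A} =
        (LINT \<omega>|size_biased_law x r v. indicator {\<omega> \<in> space (size_biased_law x r v). Z r \<omega> \<in> A} \<omega>)"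
      unfolding sp[symmetric] by simp
    also have "\<dots> = (LINT \<omega>|size_biased_law x r v. indicator A (Z r \<omega>))"
      by (intro Bochner_Integration.integral_cong) (auto simp: indicator_def)
    finally show ?thesis
      using integral_size_biased_law[OF x r(1) v, of "indicator A"] A by simp
  qed
  ultimately show ?thesis by (simp add: r_def v_def)
qed

text \<open>
  On each Borel subset of \<open>(0, \<infinity>)\<close> the limit of the conditional probabilities is the value of
  a genuine measure, so the measure built from the limiting set function is that one.
\<close>

lemma cond_extinction_law_eq:
  assumes x: "0 < x" and q: "0 < q" and t: "q < t"
  shows "cond_extinction_law P Z x q t =
    restrict_space (distr (size_biased_law x (t - q) (varphi \<psi> q)) borel (Z (t - q))) {0<..}"
proof -
  define r where "r = t - q"
  define S where "S = size_biased_law x r (varphi \<psi> q)"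
  have r: "0 \<le> r" using t by (simp add: r_def)
  interpret S: prob_space S
    unfolding S_def using x r q by (intro prob_space_size_biased_law) (auto intro: varphi_pos)
  have [measurable_cong]: "sets S = sets (P x)" by (simp add: S_def size_biased_law_def)
  have [measurable]: "Z r \<in> borel_measurable S"
    using measurable_Z[of x r] x r by (simp add: S_def size_biased_law_def)
  have sp: "space S = \<Omega>" using x by (simp add: S_def size_biased_law_def space_P)
  let ?K = "restrict_space (distr S borel (Z r)) {0<..}"
  have "cond_extinction_law P Z x q t = measure_of {0<..} (sets (restrict_space borel {0<..})) (emeasure ?K)"
    unfolding cond_extinction_law_def
  proof (rule measure_of_eq)
    show "sets (restrict_space borel {0<..}) \<subseteq> Pow {0::real<..}"
      using sets.space_closed[of "restrict_space borel {0::real<..}"] by simp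
    fix A assume "A \<in> sigma_sets {0<..} (sets (restrict_space borel {0::real<..}))"
    then have "A \<in> sets (restrict_space borel {0::real<..})"
      using sets.sigma_sets_eq[of "restrict_space borel {0::real<..}"] by simp
    then have A: "A \<in> sets borel" "A \<subseteq> {0<..}"
      by (auto simp: sets_restrict_space_iff)
    have "emeasure ?K A = emeasure S {\<omega> \<in> \<Omega>. Z r \<omega> \<in> A}"
      using A by (simp add: emeasure_restrict_space emeasure_distr sp vimage_def Int_def conj_commute)
    also have "\<dots> = ennreal (measure S {\<omega> \<in> \<Omega>. Z r \<omega> \<in> A})"
      by (rule S.emeasure_eq_measure)
    also have "\<dots> = ennreal (Lim (at_right 0) (\<lambda>s::real.
         \<P>(\<omega> in P x. Z (t - q) \<omega> \<in> A \<bar>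
            ennreal t \<le> extinction_time Z \<omega> \<and> extinction_time Z \<omega> < ennreal (t + s))))"
      using tendsto_Lim[OF trivial_limit_at_right_real cond_prob_tendsto[OF x q t A(1)]]
      by (simp add: S_def r_def)
    finally show "ennreal (Lim (at_right 0) (\<lambda>s::real.
         \<P>(\<omega> in P x. Z (t - q) \<omega> \<in> A \<bar>
            ennreal t \<le> extinction_time Z \<omega> \<and> extinction_time Z \<omega> < ennreal (t + s)))) = emeasure ?K A"
      by simp
  qed
  also have "\<dots> = ?K"
  proof -
    have "space ?K = {0<..}" "sets ?K = sets (restrict_space borel {0<..})"
      by (simp_all add: space_restrict_space sets_restrict_space_cong[OF sets_distr])
    then show ?thesis using measure_of_of_measure[of ?K] by simp
  qed
  finally show ?thesis by (simp add: S_def r_def)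
qed

text \<open>
  The restriction to \<open>(0, \<infinity>)\<close> loses nothing, since the weight \<open>Z exp (- v Z)\<close> vanishes
  where \<open>Z = 0\<close>.
\<close>

lemma laplace_cond_extinction_law:
  assumes x: "0 < x" and q: "0 < q" and t: "q < t"
  shows "(LINT z|cond_extinction_law P Z x q t. exp (- l * z)) =
    (LINT \<omega>|size_biased_law x (t - q) (varphi \<psi> q). exp (- l * Z (t - q) \<omega>))"
proof -
  define r where "r = t - q"
  define v where "v = varphi \<psi> q"
  have r: "0 \<le> r" using t by (simp add: r_def)
  have v: "0 < v" using q by (simp add: v_def varphi_pos)
  have [measurable]: "Z r \<in> borel_measurable (size_biased_law x r v)"
    using measurable_Z[of x r] x r by (simp add: size_biased_law_def)
  have "(LINT z|cond_extinction_law P Z x q t. exp (- l * z)) =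
      (LINT \<omega>|size_biased_law x r v. indicator {0<..} (Z r \<omega>) * exp (- l * Z r \<omega>))"
    unfolding cond_extinction_law_eq[OF x q t] r_def[symmetric] v_def[symmetric]
    by (simp add: integral_restrict_space integral_distr)
  also have "\<dots> = (LINT \<omega>|size_biased_law x r v. exp (- l * Z r \<omega>))"
  proof -
    have "(LINT \<omega>|P x. indicator {0<..} (Z r \<omega>) * exp (- l * Z r \<omega>) * (Z r \<omega> * exp (- (v * Z r \<omega>)))) =
        (LINT \<omega>|P x. exp (- l * Z r \<omega>) * (Z r \<omega> * exp (- (v * Z r \<omega>))))"
    proof (rule Bochner_Integration.integral_cong[OF refl])
      fix \<omega> assume "\<omega> \<in> space (P x)"
      then have "0 \<le> Z r \<omega>" using x r by (simp add: space_P Z_nonneg)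
      then show "indicator {0<..} (Z r \<omega>) * exp (- l * Z r \<omega>) * (Z r \<omega> * exp (- (v * Z r \<omega>))) =
          exp (- l * Z r \<omega>) * (Z r \<omega> * exp (- (v * Z r \<omega>)))"
        by (cases "Z r \<omega> = 0") auto
    qed
    then show ?thesis
      using integral_size_biased_law[OF x r v, of "\<lambda>z. indicator {0<..} z * exp (- l * z)"]
        integral_size_biased_law[OF x r v, of "\<lambda>z. exp (- l * z)"]
      by simp
  qed
  finally show ?thesis by (simp add: r_def v_def)
qed

text \<open>
  With \<open>c = \<phi>(l + v) - q\<close>, the two size-biased expectations involve \<^term>\<open>varphi \<psi>\<close> at \<open>t + c\<close> and at
  \<open>t\<close>. The exponential factors, and with them the starting point \<open>x\<close>, disappear in the limit because
  \<^term>\<open>varphi \<psi>\<close> tends to 0.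
\<close>

lemma laplace_size_biased_law_tendsto:
  assumes x: "0 < x" and q: "0 < q" and l: "0 < l"
  shows "((\<lambda>t. LINT \<omega>|size_biased_law x (t - q) (varphi \<psi> q). exp (- l * Z (t - q) \<omega>)) \<longlongrightarrow>
    exp (- \<alpha> * (phi \<psi> (l + varphi \<psi> q) - q)) * (\<psi> (varphi \<psi> q) / \<psi> (l + varphi \<psi> q))) at_top"
proof -
  define v where "v = varphi \<psi> q"
  define c where "c = phi \<psi> (l + v) - q"
  have v: "0 < v" "phi \<psi> v = q" using q by (auto simp: v_def varphi_pos phi_varphi)
  note shift = filterlim_add_const_at_top[of c]
  have varphi0: "(varphi \<psi> \<longlongrightarrow> 0) at_top"
    using varphi_tendsto_0 by (simp add: filterlim_at)
  have "((\<lambda>t. \<psi> (varphi \<psi> (t + c)) / \<psi> (varphi \<psi> t) * (\<psi> v / \<psi> (l + v)) *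
      (exp (- (x * varphi \<psi> (t + c))) / exp (- (x * varphi \<psi> t)))) \<longlongrightarrow>
      exp (- \<alpha> * c) * (\<psi> v / \<psi> (l + v)) * (exp (- (x * 0)) / exp (- (x * 0)))) at_top"
    by (intro tendsto_intros psi_varphi_shift_ratio varphi0 filterlim_compose[OF varphi0 shift]) auto
  then have "((\<lambda>t. \<psi> (varphi \<psi> (t + c)) / \<psi> (varphi \<psi> t) * (\<psi> v / \<psi> (l + v)) *
      (exp (- (x * varphi \<psi> (t + c))) / exp (- (x * varphi \<psi> t)))) \<longlongrightarrow>
      exp (- \<alpha> * c) * (\<psi> v / \<psi> (l + v))) at_top"
    by simp
  then have "((\<lambda>t. LINT \<omega>|size_biased_law x (t - q) v. exp (- l * Z (t - q) \<omega>)) \<longlongrightarrow>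
      exp (- \<alpha> * c) * (\<psi> v / \<psi> (l + v))) at_top"
  proof (rule Lim_transform_eventually)
    show "eventually (\<lambda>t. \<psi> (varphi \<psi> (t + c)) / \<psi> (varphi \<psi> t) * (\<psi> v / \<psi> (l + v)) *
      (exp (- (x * varphi \<psi> (t + c))) / exp (- (x * varphi \<psi> t))) =
      (LINT \<omega>|size_biased_law x (t - q) v. exp (- l * Z (t - q) \<omega>))) at_top"
      using eventually_ge_at_top[of q]
    proof eventually_elim
      case (elim t)
      then have r: "0 \<le> t - q" by simp
      have lv: "0 < l + v" using l v by simp
      have *: "t - q + phi \<psi> (l + v) = t + c" "t - q + phi \<psi> v = t" using v by (auto simp: c_def)
      show ?case
        unfolding laplace_size_biased_law[OF x r v(1)]
          size_biased_expectation[OF less_imp_le[OF x] r lv] size_biased_expectation[OF less_imp_le[OF x] r v(1)] *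
        using x by (simp add: field_simps)
    qed
  qed
  then show ?thesis by (simp add: c_def v_def)
qed

end

section \<open>The limit law\<close>

context branching_mechanism
begin

definition limit_laplace :: "real \<Rightarrow> real \<Rightarrow> real" where
  "limit_laplace q l = exp (- \<alpha> * (phi \<psi> (l + varphi \<psi> q) - q)) * (\<psi> (varphi \<psi> q) / \<psi> (l + varphi \<psi> q))"

lemma limit_laplace_at_0:
  assumes q: "0 < q" shows "(limit_laplace q \<longlongrightarrow> 1) (at_right 0)"
proof -
  define v where "v = varphi \<psi> q"
  have v: "0 < v" "phi \<psi> v = q" using q by (auto simp: v_def varphi_pos phi_varphi)
  have "((\<lambda>l. l + v) \<longlongrightarrow> 0 + v) (at_right 0)" by (intro tendsto_intros)
  then have lim: "((\<lambda>l. l + v) \<longlongrightarrow> v) (at_right 0)" by simp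
  have "((\<lambda>l. exp (- \<alpha> * (phi \<psi> (l + v) - q)) * (\<psi> v / \<psi> (l + v))) \<longlongrightarrow>
      exp (- \<alpha> * (phi \<psi> v - q)) * (\<psi> v / \<psi> v)) (at_right 0)"
    using psi_pos[OF v(1)]
    by (intro tendsto_intros isCont_tendsto_compose[OF isCont_phi[OF v(1)] lim]
        isCont_tendsto_compose[OF isCont_psi[OF v(1)] lim]) simp
  then show ?thesis
    using psi_pos[OF v(1)] v by (simp add: limit_laplace_def[abs_def] v_def[symmetric])
qed

lemma limit_laplace_at_top: "(limit_laplace q \<longlongrightarrow> 0) at_top"
proof -
  let ?v = "varphi \<psi> q"
  note shift = filterlim_add_const_at_top[of ?v]
  have "((\<lambda>l. inverse (\<psi> (l + ?v))) \<longlongrightarrow> 0) at_top"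
    by (intro tendsto_inverse_0_at_top filterlim_compose[OF psi_at_top shift])
  then have "((\<lambda>l. exp (- \<alpha> * (phi \<psi> (l + ?v) - q)) * (\<psi> ?v * inverse (\<psi> (l + ?v)))) \<longlongrightarrow>
      exp (- \<alpha> * (0 - q)) * (\<psi> ?v * 0)) at_top"
    by (intro tendsto_intros filterlim_compose[OF phi_tendsto_0 shift])
  then show ?thesis by (simp add: limit_laplace_def[abs_def] divide_inverse)
qed

text \<open>
  The primitive of \<open>y \<mapsto> exp (- \<alpha> y)\<close> that vanishes at 0. It merges the cases
  \<open>\<alpha> > 0\<close> and \<open>\<alpha> = 0\<close> in the transform of \<open>W\<close>.
\<close>

definition exp_primitive :: "real \<Rightarrow> real" where
  "exp_primitive y = (if \<alpha> > 0 then (1 - exp (- \<alpha> * y)) / \<alpha> else y)"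

lemma DERIV_exp_primitive: "(exp_primitive has_real_derivative exp (- \<alpha> * y)) (at y)"
proof (cases "\<alpha> > 0")
  case True
  then have "((\<lambda>y. (1 - exp (- \<alpha> * y)) / \<alpha>) has_real_derivative exp (- \<alpha> * y)) (at y)"
    by (auto intro!: derivative_eq_intros)
  then show ?thesis using True by (simp add: exp_primitive_def[abs_def])
next
  case False
  then have "exp_primitive = (\<lambda>y. y)"
    unfolding exp_primitive_def[abs_def] by simp
  moreover have "((\<lambda>y. y) has_real_derivative exp (- \<alpha> * y)) (at y)"
    using False alpha_nonneg by simp
  ultimately show ?thesis by (simp only:)
qed

lemma exp_primitive_0: "exp_primitive 0 = 0"
  by (simp add: exp_primitive_def)

lemma exp_primitive_pos: "0 < y \<Longrightarrow> 0 < exp_primitive y"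
  by (simp add: exp_primitive_def)

text \<open>
  The integral of \<open>limit_laplace q\<close> over \<open>[l, \<infinity>)\<close>: the factor \<open>1/\<psi>\<close> is minus the derivative
  of \<open>\<phi>\<close>, so the substitution \<open>y = \<phi>(s + v)\<close> leaves \<open>exp (- \<alpha> y)\<close> to be integrated.
\<close>

definition tail_integral :: "real \<Rightarrow> real \<Rightarrow> real" where
  "tail_integral q l = exp (\<alpha> * q) * \<psi> (varphi \<psi> q) * exp_primitive (phi \<psi> (l + varphi \<psi> q))"

lemma tail_integral_pos:
  assumes "0 < q" "0 \<le> l" shows "0 < tail_integral q l"
proof -
  have "0 < varphi \<psi> q" using assms by (intro varphi_pos)
  then have "0 < \<psi> (varphi \<psi> q)" "0 < phi \<psi> (l + varphi \<psi> q)"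
    using assms by (auto intro!: psi_pos phi_pos)
  then show ?thesis by (simp add: tail_integral_def exp_primitive_pos)
qed

lemma DERIV_tail_integral:
  assumes "0 < q" "0 \<le> l"
  shows "((\<lambda>l. - tail_integral q l) has_real_derivative limit_laplace q l) (at l)"
proof -
  define v where "v = varphi \<psi> q"
  have lv: "0 < l + v" using assms varphi_pos[of q] by (simp add: v_def)
  have "((\<lambda>l. phi \<psi> (l + v)) has_real_derivative - (1 / \<psi> (l + v))) (at l)"
    using DERIV_phi[OF lv] by (simp add: DERIV_shift)
  then have "((\<lambda>l. exp_primitive (phi \<psi> (l + v))) has_real_derivative
      exp (- \<alpha> * phi \<psi> (l + v)) * - (1 / \<psi> (l + v))) (at l)"
    by (rule DERIV_chain2[where f = exp_primitive, OF DERIV_exp_primitive])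
  then have "((\<lambda>l. - (exp (\<alpha> * q) * \<psi> v * exp_primitive (phi \<psi> (l + v)))) has_real_derivative
      - (exp (\<alpha> * q) * \<psi> v * (exp (- \<alpha> * phi \<psi> (l + v)) * - (1 / \<psi> (l + v))))) (at l)"
    by (intro DERIV_minus DERIV_cmult)
  moreover have "- (exp (\<alpha> * q) * \<psi> v * (exp (- \<alpha> * phi \<psi> (l + v)) * - (1 / \<psi> (l + v)))) =
      limit_laplace q l"
  proof -
    have "exp (- \<alpha> * (phi \<psi> (l + v) - q)) = exp (\<alpha> * q) * exp (- \<alpha> * phi \<psi> (l + v))"
      by (simp add: algebra_simps flip: exp_add)
    then show ?thesis by (simp add: limit_laplace_def v_def)
  qed
  ultimately show ?thesis by (simp add: tail_integral_def v_def)
qed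

lemma tail_integral_at_top: "((\<lambda>l. - tail_integral q l) \<longlongrightarrow> 0) at_top"
proof -
  note shift = filterlim_add_const_at_top[of "varphi \<psi> q"]
  have "((\<lambda>l. exp_primitive (phi \<psi> (l + varphi \<psi> q))) \<longlongrightarrow> exp_primitive 0) at_top"
    by (rule isCont_tendsto_compose[OF DERIV_isCont[OF DERIV_exp_primitive]
          filterlim_compose[OF phi_tendsto_0 shift]])
  then have "((\<lambda>l. - (exp (\<alpha> * q) * \<psi> (varphi \<psi> q) * exp_primitive (phi \<psi> (l + varphi \<psi> q)))) \<longlongrightarrow>
      - (exp (\<alpha> * q) * \<psi> (varphi \<psi> q) * exp_primitive 0)) at_top"
    by (intro tendsto_intros)
  then show ?thesis by (simp add: tail_integral_def[abs_def] exp_primitive_0)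
qed

lemma is_W_iff:
  assumes q: "0 < q"
  shows "is_W \<alpha> \<psi> q N W \<longleftrightarrow> positive_rv N W \<and>
    (\<forall>l>0. (LINT w|N. exp (- l * W w)) = tail_integral q l / tail_integral q 0)"
proof -
  have "0 < varphi \<psi> q" using q by (rule varphi_pos)
  then have "tail_integral q l / tail_integral q 0 =
      (if \<alpha> > 0
       then (1 - exp (- \<alpha> * phi \<psi> (l + varphi \<psi> q))) / (1 - exp (- \<alpha> * q))
       else phi \<psi> (l + varphi \<psi> q) / q)" for l
    using psi_pos[of "varphi \<psi> q"] phi_varphi[OF q]
    by (simp add: tail_integral_def exp_primitive_def)
  then show ?thesis by (simp add: is_W_def)
qed

end

theorem theorem4p3:
  fixes \<alpha> \<sigma> :: real and \<pi> :: "real measure" and \<psi> :: "real \<Rightarrow> real"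
    and \<Omega> :: "'w set" and F :: "ennreal \<Rightarrow> 'w measure"
    and u :: "real \<Rightarrow> real \<Rightarrow> real"
    and P :: "real \<Rightarrow> 'w measure" and Z :: "real \<Rightarrow> 'w \<Rightarrow> real"
    and q :: real
  assumes "branching_mechanism \<alpha> \<sigma> \<pi> \<psi>"
    and "cb_process \<Omega> F \<psi> u P Z"
    and "q > 0"
  shows "\<exists>(N :: real measure) V.
    positive_rv N V \<and>
    (\<forall>l>0. \<forall>x>0.
      ((\<lambda>t. LINT z|cond_extinction_law P Z x q t. exp (- l * z))
         \<longlongrightarrow> (LINT w|N. exp (- l * V w))) at_top \<and>
      (LINT w|N. exp (- l * V w)) =
        exp (- \<alpha> * (phi \<psi> (l + varphi \<psi> q) - q)) *
        (\<psi> (varphi \<psi> q) / \<psi> (l + varphi \<psi> q))) \<and>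
    (\<exists>(M :: real measure) W. is_W \<alpha> \<psi> q M W) \<and>
    (\<forall>(M :: real measure) W. is_W \<alpha> \<psi> q M W \<longrightarrow>
      integrable M W \<and>
      distr N borel V =
        density (distr M borel W) (\<lambda>r. ennreal (r / (LINT w|M. W w))))"
proof -
  interpret branching_mechanism \<alpha> \<sigma> \<pi> \<psi> by fact
  interpret cb_process \<Omega> F \<psi> u P Z by fact
  interpret cb_branching \<alpha> \<sigma> \<pi> \<psi> \<Omega> F u P Z ..
  note q = \<open>q > 0\<close>
  define v where "v = varphi \<psi> q"
  have v: "0 < v" using q by (simp add: v_def varphi_pos)
  let ?law = "\<lambda>x t. size_biased_law x (t - q) v"
  have lim: "((\<lambda>t. LINT \<omega>|?law x t. exp (- l * Z (t - q) \<omega>)) \<longlongrightarrow> limit_laplace q l) at_top"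
    if "0 < l" "0 < x" for l x
    using laplace_size_biased_law_tendsto[OF that(2) q that(1)] by (simp add: limit_laplace_def v_def)
  have "\<exists>(N :: real measure) V. positive_rv N V \<and> (\<forall>l>0. (LINT w|N. exp (- l * V w)) = limit_laplace q l)"
  proof (rule laplace_continuity[where M = "\<lambda>n. ?law 1 (real n + q)" and X = "\<lambda>n. Z (real n)"])
    fix n :: nat
    show "prob_space (?law 1 (real n + q))"
      using v by (intro prob_space_size_biased_law) auto
    show "Z (real n) \<in> borel_measurable (?law 1 (real n + q))"
      using measurable_Z[of 1 "real n"] by (simp add: size_biased_law_def)
    show "AE \<omega> in ?law 1 (real n + q). 0 \<le> Z (real n) \<omega>"
      by (rule AE_I2) (simp add: size_biased_law_def space_P Z_nonneg)
  next
    fix l :: real assume l: "0 < l"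
    have "filterlim (\<lambda>n. real n + q) at_top sequentially" by real_asymp
    from filterlim_compose[OF lim[OF l zero_less_one] this]
    show "(\<lambda>n. LINT \<omega>|?law 1 (real n + q). exp (- l * Z (real n) \<omega>)) \<longlonglongrightarrow> limit_laplace q l"
      by simp
  qed (use limit_laplace_at_0[OF q] limit_laplace_at_top in auto)
  then obtain N :: "real measure" and V where V: "positive_rv N V"
    and laplace: "\<And>l. 0 < l \<Longrightarrow> (LINT w|N. exp (- l * V w)) = limit_laplace q l"
    by blast
  have conv: "((\<lambda>t. LINT z|cond_extinction_law P Z x q t. exp (- l * z))
         \<longlongrightarrow> (LINT w|N. exp (- l * V w))) at_top" if "0 < l" "0 < x" for l x
    unfolding laplace[OF that(1)] using lim[OF that]
  proof (rule Lim_transform_eventually)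
    show "eventually (\<lambda>t. (LINT \<omega>|?law x t. exp (- l * Z (t - q) \<omega>)) =
        (LINT z|cond_extinction_law P Z x q t. exp (- l * z))) at_top"
      using eventually_gt_at_top[of q]
      by (rule eventually_mono) (use laplace_cond_extinction_law[OF that(2) q] in \<open>simp add: v_def\<close>)
  qed
  \<comment> \<open>The normalisation \<open>J 0 = E[1/V]\<close> needs the transform at 0 as well.\<close>
  have laplace0: "(LINT w|N. exp (- l * V w)) = limit_laplace q l" if "0 \<le> l" for l
  proof (cases "l = 0")
    case True
    interpret prob_space N using V by (simp add: positive_rv_def)
    show ?thesis
      using True phi_varphi[OF q] psi_pos[OF v] by (simp add: limit_laplace_def v_def prob_space)
  qed (use laplace that in simp)
  have J: "(\<integral>\<^sup>+w. ennreal (exp (- l * V w) / V w) \<partial>N) = ennreal (tail_integral q l)" if "0 \<le> l" for l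
  proof -
    have "(\<integral>\<^sup>+w. ennreal (exp (- l * V w) / V w) \<partial>N) = ennreal (0 - (- tail_integral q l))"
    proof (rule nn_integral_laplace_over_value[OF V that _ tail_integral_at_top])
      fix s assume "l \<le> s"
      then have "0 \<le> s" using that by simp
      then show "((\<lambda>l. - tail_integral q l) has_real_derivative (LINT w|N. exp (- s * V w))) (at s)"
        using DERIV_tail_integral[OF q] laplace0 by simp
    qed
    then show ?thesis by simp
  qed
  have J_pos: "0 < tail_integral q 0" "\<And>l. 0 \<le> l \<Longrightarrow> 0 \<le> tail_integral q l"
    using tail_integral_pos[OF q] by (auto intro: less_imp_le)
  note W = inverse_size_bias[OF V J J_pos]
  have "\<exists>(M :: real measure) W. is_W \<alpha> \<psi> q M W"
    unfolding is_W_iff[OF q] using W(1,2) by blast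
  moreover have "integrable M W \<and> distr N borel V =
      density (distr M borel W) (\<lambda>r. ennreal (r / (LINT w|M. W w)))"
    if "is_W \<alpha> \<psi> q M W" for M :: "real measure" and W
    by (rule W(3)) (use that in \<open>auto simp: is_W_iff[OF q]\<close>)
  ultimately show ?thesis
    using V conv laplace unfolding limit_laplace_def by (intro exI[of _ N] exI[of _ V]) blast
qed

end
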